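(* Up to equivalence, there are exactly five extremal self-dual linear Kleinian codes, namely $\gamma_1$ (length $1$), $\epsilon_2$ (length $2$), $\delta_3^+$ (length $3$), the shorter Hexacode $\mathcal{C}_5$ (length $5$) and the Hexacode $\mathcal{C}_6$ (length $6$).
   Context: Let $K=\{0,a,b,c\}$ be the Kleinian four-group. A linear code of length $n$ is a subgroup $C\subseteq K^n$; $\mathrm{wt}(\mathbf{x})$ is the number of nonzero coordinates. Define $x\cdot y\in\mathbb{F}_2$ for $x,y\in K$ by $x\cdot y=1$ iff $x,y$ are nonzero and distinct; $(\mathbf{x},\mathbf{y})=\sum_ix_i\cdot y_i$; $C^\perp=\{\mathbf{x}:(\mathbf{x},\mathbf{y})=0\ \forall \mathbf{y}\in C\}$; $C$ is self-dual if $C=C^\perp$. $W_C(u,v)=\sum_{\mathbf{x}\in C}u^{n-\mathrm{wt}(\mathbf{x})}v^{\mathrm{wt}(\mathbf{x})}$. The group $G=S_3^n\rtimes S_n$ acts on $K^n$ by permuting coordinates and independently permuting $a,b,c$ in each coordinate; codes $C,D$ are equivalent if $gC=D$ for some $g\in G$. With $m=\lfloor n/2\rfloor$, there are unique numbers $a_0,\dots,a_m$ such that $\sum_{i=0}^m a_i(u+v)^{n-2i}(v(u-v))^i=u^n+0\cdot u^{n-1}v+\dots+0\cdot u^{n-m}v^m+A_{m+1}u^{n-m-1}v^{m+1}+\dots+A_nv^n$ for some $A_{m+1},\dots,A_n$; this polynomial is the extremal weight enumerator of length $n$, and a self-dual code of length $n$ is extremal if its weight enumerator equals it. Codes: $\gamma_1=\{(0),(a)\}$;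 $\epsilon_2=\{(0,0),(a,a),(b,b),(c,c)\}$; $\delta_3^+$ is the subgroup of $K^3$ generated by $(a,a,0),(0,a,a),(b,b,b)$; $\mathcal{C}_6$ is the subgroup of $K^6$ generated by $(a,0,a,0,b,b)$, $(a,0,b,b,a,0)$, $(b,b,a,0,a,0)$, $(0,0,a,a,a,a)$, $(a,a,0,0,a,a)$, $(b,0,b,0,c,a)$; $\mathcal{C}_5\subseteq K^5$ is obtained from $\mathcal{C}_6$ by taking the codewords whose first coordinate lies in $\{0,a\}$ and deleting the first coordinate (a self-dual code with weight enumerator $u^5+10u^2v^3+15uv^4+6v^5$). *)

theory Defs
  imports
    "HOL-Algebra.Generated_Groups"
    "HOL-Combinatorics.Permutations"
    "HOL-Computational_Algebra.Polynomial"
    "HOL-Library.Z2"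
begin

datatype klein = KO | KA | KB | KC

instantiation klein :: ab_group_add
begin

definition zero_klein :: klein where "0 = KO"

definition plus_klein :: "klein \<Rightarrow> klein \<Rightarrow> klein" where
  "x + y = (case x of
      KO \<Rightarrow> y
    | KA \<Rightarrow> (case y of KO \<Rightarrow> KA | KA \<Rightarrow> KO | KB \<Rightarrow> KC | KC \<Rightarrow> KB)
    | KB \<Rightarrow> (case y of KO \<Rightarrow> KB | KA \<Rightarrow> KC | KB \<Rightarrow> KO | KC \<Rightarrow> KA)
    | KC \<Rightarrow> (case y of KO \<Rightarrow> KC | KA \<Rightarrow> KB | KB \<Rightarrow> KA | KC \<Rightarrow> KO))"

definition uminus_klein :: "klein \<Rightarrow> klein" where "- x = (x :: klein)"

definition minus_klein :: "klein \<Rightarrow> klein \<Rightarrow> klein" where "x - y = x + (y :: klein)"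

instance
  by standard
    (simp_all add: zero_klein_def plus_klein_def uminus_klein_def minus_klein_def
      split: klein.splits)

end

text \<open>A word of length \<open>n\<close> is a list of length \<open>n\<close>; the group \<open>K\<^sup>n\<close> is written
  multiplicatively, as everywhere in HOL-Algebra.\<close>

definition word_group :: "nat \<Rightarrow> klein list monoid" where
  "word_group n = \<lparr>carrier = {x. length x = n}, monoid.mult = map2 (+), one = replicate n 0\<rparr>"

lemma group_word_group: "group (word_group n)"
proof (rule groupI)
  fix x y z
  assume "x \<in> carrier (word_group n)" "y \<in> carrier (word_group n)" "z \<in> carrier (word_group n)"
  then show "x \<otimes>\<^bsub>word_group n\<^esub> y \<otimes>\<^bsub>word_group n\<^esub> z
      = x \<otimes>\<^bsub>word_group n\<^esub> (y \<otimes>\<^bsub>word_group n\<^esub> z)"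
    by (auto simp: word_group_def add.assoc intro!: nth_equalityI)
next
  fix x
  assume x: "x \<in> carrier (word_group n)"
  then show "\<exists>y\<in>carrier (word_group n). y \<otimes>\<^bsub>word_group n\<^esub> x = \<one>\<^bsub>word_group n\<^esub>"
    by (intro bexI[of _ "map uminus x"]) (auto simp: word_group_def intro!: nth_equalityI)
qed (auto simp: word_group_def intro!: nth_equalityI)

definition linear_code :: "nat \<Rightarrow> klein list set \<Rightarrow> bool" where
  "linear_code n C \<longleftrightarrow> subgroup C (word_group n)"

definition wt :: "klein list \<Rightarrow> nat" where
  "wt x = card {i. i < length x \<and> x ! i \<noteq> 0}"

definition kdot :: "klein \<Rightarrow> klein \<Rightarrow> bit" where
  "kdot x y = (if x \<noteq> 0 \<and> y \<noteq> 0 \<and> x \<noteq> y then 1 else 0)"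

definition word_inner :: "nat \<Rightarrow> klein list \<Rightarrow> klein list \<Rightarrow> bit" where
  "word_inner n x y = (\<Sum>i<n. kdot (x ! i) (y ! i))"

definition dual_code :: "nat \<Rightarrow> klein list set \<Rightarrow> klein list set" where
  "dual_code n C = {x \<in> carrier (word_group n). \<forall>y\<in>C. word_inner n x y = 0}"

definition self_dual :: "nat \<Rightarrow> klein list set \<Rightarrow> bool" where
  "self_dual n C \<longleftrightarrow> linear_code n C \<and> C = dual_code n C"

text \<open>The polynomial ring \<open>\<real>[u, v]\<close> is represented as \<open>(\<real>[u])[v]\<close>.\<close>

definition indet_u :: "real poly poly" where "indet_u = [:[:0, 1:]:]"

definition indet_v :: "real poly poly" where "indet_v = [:0, 1:]"

definition const2 :: "real \<Rightarrow> real poly poly" where "const2 c = [:[:c:]:]"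

definition weight_enum :: "nat \<Rightarrow> klein list set \<Rightarrow> real poly poly" where
  "weight_enum n C = (\<Sum>x\<in>C. indet_u ^ (n - wt x) * indet_v ^ wt x)"

definition is_extremal_weight_enum :: "nat \<Rightarrow> real poly poly \<Rightarrow> bool" where
  "is_extremal_weight_enum n P \<longleftrightarrow>
    (\<exists>a A.
      P = (\<Sum>i\<le>n div 2. const2 (a i) * (indet_u + indet_v) ^ (n - 2 * i)
                          * (indet_v * (indet_u - indet_v)) ^ i) \<and>
      P = indet_u ^ n + (\<Sum>j=n div 2 + 1..n. const2 (A j) * indet_u ^ (n - j) * indet_v ^ j))"

text \<open>The description is justified by the existence and uniqueness of this polynomial,
  proved in \<open>ex1_extremal_weight_enum\<close> below.\<close>

definition extremal_weight_enum :: "nat \<Rightarrow> real poly poly" where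
  "extremal_weight_enum n = (THE P. is_extremal_weight_enum n P)"

definition extremal_code :: "nat \<Rightarrow> klein list set \<Rightarrow> bool" where
  "extremal_code n C \<longleftrightarrow> self_dual n C \<and> weight_enum n C = extremal_weight_enum n"

text \<open>A code is paired with its length. Length 0 is excluded: the trivial code of length 0
  satisfies the defining condition trivially.\<close>

definition extremal_codes :: "(nat \<times> klein list set) set" where
  "extremal_codes = {(n, C). n \<ge> 1 \<and> extremal_code n C}"

text \<open>A pair \<open>(\<pi>, \<sigma>)\<close> stands for an element of the wreath product of \<open>S\<^sub>3\<close>, permuting the nonzero
  elements, by \<open>S\<^sub>n\<close>, permuting the coordinates.\<close>

definition sym_pairs :: "nat \<Rightarrow> ((nat \<Rightarrow> nat) \<times> (nat \<Rightarrow> klein \<Rightarrow> klein)) set" where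
  "sym_pairs n = {(\<pi>, \<sigma>). \<pi> permutes {..<n} \<and> (\<forall>i<n. \<sigma> i permutes {KA, KB, KC})}"

definition act_word :: "(nat \<Rightarrow> nat) \<times> (nat \<Rightarrow> klein \<Rightarrow> klein) \<Rightarrow> klein list \<Rightarrow> klein list" where
  "act_word g x = map (\<lambda>i. snd g i (x ! fst g i)) [0..<length x]"

definition code_equiv :: "((nat \<times> klein list set) \<times> (nat \<times> klein list set)) set" where
  "code_equiv = {((n, C), (n', D)). n = n' \<and> linear_code n C \<and> linear_code n D \<and>
      (\<exists>g\<in>sym_pairs n. act_word g ` C = D)}"

definition gamma1 :: "klein list set" where
  "gamma1 = {[KO], [KA]}"

definition epsilon2 :: "klein list set" where
  "epsilon2 = {[KO, KO], [KA, KA], [KB, KB], [KC, KC]}"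

definition delta3_plus :: "klein list set" where
  "delta3_plus = generate (word_group 3) {[KA, KA, KO], [KO, KA, KA], [KB, KB, KB]}"

definition hexacode :: "klein list set" where
  "hexacode = generate (word_group 6)
    {[KA, KO, KA, KO, KB, KB],
     [KA, KO, KB, KB, KA, KO],
     [KB, KB, KA, KO, KA, KO],
     [KO, KO, KA, KA, KA, KA],
     [KA, KA, KO, KO, KA, KA],
     [KB, KO, KB, KO, KC, KA]}"

definition shorter_hexacode :: "klein list set" where
  "shorter_hexacode = {tl x | x. x \<in> hexacode \<and> hd x \<in> {KO, KA}}"

lemma code_equivE:
  assumes "(p, q) \<in> code_equiv"
  obtains n C D \<pi> \<sigma> where "p = (n, C)" "q = (n, D)" "linear_code n C" "linear_code n D"
    "(\<pi>, \<sigma>) \<in> sym_pairs n" "act_word (\<pi>, \<sigma>) ` C = D"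
  using assms unfolding code_equiv_def by auto

lemma sym_pairsD:
  assumes "(\<pi>, \<sigma>) \<in> sym_pairs n"
  shows "\<pi> permutes {..<n}" "\<And>i. i < n \<Longrightarrow> \<sigma> i permutes {KA, KB, KC}"
  using assms by (simp_all add: sym_pairs_def)

lemma equiv_code_equiv: "equiv {(n, C). linear_code n C} code_equiv"
proof (rule equivI)
  have len: "length x = n" if "linear_code n C" "x \<in> C" for n C x
    using that subgroup.subset[of C "word_group n"] by (auto simp: linear_code_def word_group_def)
  show "code_equiv \<subseteq> {(n, C). linear_code n C} \<times> {(n, C). linear_code n C}"
    by (auto simp: code_equiv_def)
  show "refl_on {(n, C). linear_code n C} code_equiv"
  proof (rule refl_onI)
    fix p :: "nat \<times> klein list set"
    assume "p \<in> {(n, C). linear_code n C}"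
    then obtain n C where p: "p = (n, C)" "linear_code n C" by auto
    have "(id, \<lambda>_. id) \<in> sym_pairs n" by (auto simp: sym_pairs_def permutes_id)
    moreover have "act_word (id, \<lambda>_. id) x = x" for x
      by (auto simp: act_word_def map_nth)
    then have "act_word (id, \<lambda>_. id) ` C = C" by simp
    ultimately show "(p, p) \<in> code_equiv" using p unfolding code_equiv_def by blast
  qed
  show "sym code_equiv"
  proof (rule symI)
    fix p q
    assume "(p, q) \<in> code_equiv"
    then obtain n C D \<pi> \<sigma> where pq: "p = (n, C)" "q = (n, D)" "linear_code n C" "linear_code n D"
      and "(\<pi>, \<sigma>) \<in> sym_pairs n" and D: "act_word (\<pi>, \<sigma>) ` C = D"
      by (rule code_equivE)
    note g = sym_pairsD[OF \<open>(\<pi>, \<sigma>) \<in> sym_pairs n\<close>]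
    define \<rho> where "\<rho> = inv_into UNIV \<pi>"
    have p': "\<rho> permutes {..<n}" unfolding \<rho>_def by (rule permutes_inv[OF g(1)])
    have lt: "\<rho> i < n \<and> \<pi> i < n" if "i < n" for i
      using that permutes_in_image[OF p', of i] permutes_in_image[OF g(1), of i] by auto
    let ?h = "(\<rho>, \<lambda>i. inv_into UNIV (\<sigma> (\<rho> i)))"
    have h: "?h \<in> sym_pairs n"
      using p' lt g(2) by (auto simp: sym_pairs_def intro!: permutes_inv)
    have "act_word ?h (act_word (\<pi>, \<sigma>) x) = x" if "x \<in> C" for x
    proof (rule nth_equalityI)
      fix i assume "i < length (act_word ?h (act_word (\<pi>, \<sigma>) x))"
      then have i: "i < n" "length x = n" using len[OF pq(3) that] by (auto simp: act_word_def)
      show "act_word ?h (act_word (\<pi>, \<sigma>) x) ! i = x ! i"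
        using i lt[OF i(1)] permutes_inverses[OF g(1), folded \<rho>_def] permutes_inverses[OF g(2)[of "\<rho> i"]]
        by (simp add: act_word_def)
    qed (simp add: act_word_def)
    then have "act_word ?h ` D = C" unfolding D[symmetric] image_image by simp
    then show "(q, p) \<in> code_equiv" using h pq unfolding code_equiv_def by blast
  qed
  show "trans code_equiv"
  proof (rule transI)
    fix p q r
    assume p: "(p, q) \<in> code_equiv" and q: "(q, r) \<in> code_equiv"
    from p obtain n C D \<pi> \<sigma> where
      pq: "p = (n, C)" "q = (n, D)" "linear_code n C" "linear_code n D"
      and "(\<pi>, \<sigma>) \<in> sym_pairs n" and D: "act_word (\<pi>, \<sigma>) ` C = D"
      by (rule code_equivE)
    note g = sym_pairsD[OF \<open>(\<pi>, \<sigma>) \<in> sym_pairs n\<close>]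
    from q obtain n' D' F \<pi>' \<sigma>' where
      qr: "q = (n', D')" "r = (n', F)" "linear_code n' F"
      and g'': "(\<pi>', \<sigma>') \<in> sym_pairs n'"
      and F': "act_word (\<pi>', \<sigma>') ` D' = F"
      by (rule code_equivE)
    have r: "r = (n, F)" "linear_code n F" and F: "act_word (\<pi>', \<sigma>') ` D = F"
      and g0: "(\<pi>', \<sigma>') \<in> sym_pairs n"
      using pq(2) qr g'' F' by simp_all
    note g' = sym_pairsD[OF g0]
    have lt: "\<pi>' i < n" if "i < n" for i
      using that permutes_in_image[OF g'(1), of i] by auto
    let ?h = "(\<pi> \<circ> \<pi>', \<lambda>i. \<sigma>' i \<circ> \<sigma> (\<pi>' i))"
    have h: "?h \<in> sym_pairs n"
      using g g' lt by (auto simp: sym_pairs_def intro!: permutes_compose)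
    have "act_word ?h x = act_word (\<pi>', \<sigma>') (act_word (\<pi>, \<sigma>) x)" if "x \<in> C" for x
      using lt len[OF pq(3) that] by (auto simp: act_word_def)
    then have "act_word ?h ` C = F" unfolding F[symmetric] D[symmetric] image_image by simp
    then show "(p, r) \<in> code_equiv" using h pq r unfolding code_equiv_def by blast
  qed
qed

definition monic_form :: "nat \<Rightarrow> nat \<Rightarrow> real poly poly \<Rightarrow> bool" where
  "monic_form n k P \<longleftrightarrow> k \<le> n \<and> (\<exists>c. P = indet_u ^ (n - k) * indet_v ^ k
      + (\<Sum>j=Suc k..n. const2 (c j) * indet_u ^ (n - j) * indet_v ^ j))"

lemma const2_hom:
  "const2 0 = 0" "const2 1 = 1" "const2 (x + y) = const2 x + const2 y"
  "const2 (x - y) = const2 x - const2 y" "const2 (x * y) = const2 x * const2 y"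
  by (simp_all add: const2_def one_pCons)

lemma monic_form_one: "monic_form 0 0 1"
  by (simp add: monic_form_def)

lemma monic_form_mult_v:
  assumes "monic_form n k P"
  shows "monic_form (Suc n) (Suc k) (indet_v * P)"
proof -
  obtain c where k: "k \<le> n" and P: "P = indet_u ^ (n - k) * indet_v ^ k
      + (\<Sum>j=Suc k..n. const2 (c j) * indet_u ^ (n - j) * indet_v ^ j)"
    using assms by (auto simp: monic_form_def)
  have "(\<Sum>j=Suc (Suc k)..Suc n. const2 (c (j - 1)) * indet_u ^ (Suc n - j) * indet_v ^ j)
      = (\<Sum>j=Suc k..n. const2 (c j) * indet_u ^ (n - j) * indet_v ^ Suc j)"
    by (subst sum.shift_bounds_cl_Suc_ivl) simp
  then have "indet_v * P = indet_u ^ (Suc n - Suc k) * indet_v ^ Suc k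
      + (\<Sum>j=Suc (Suc k)..Suc n. const2 (c (j - 1)) * indet_u ^ (Suc n - j) * indet_v ^ j)"
    unfolding P by (simp add: algebra_simps sum_distrib_left)
  then show ?thesis
    unfolding monic_form_def using k by (intro conjI exI[of _ "\<lambda>j. c (j - 1)"]) auto
qed

lemma monic_form_mult_linear:
  assumes "monic_form n k P"
  shows "monic_form (Suc n) k ((indet_u + const2 s * indet_v) * P)"
proof -
  obtain c where k: "k \<le> n" and P: "P = indet_u ^ (n - k) * indet_v ^ k
      + (\<Sum>j=Suc k..n. const2 (c j) * indet_u ^ (n - j) * indet_v ^ j)"
    using assms by (auto simp: monic_form_def)
  define d where "d j = (if j = k then 1 else if k < j \<and> j \<le> n then c j else 0)" for j
  have P': "P = (\<Sum>j=k..n. const2 (d j) * indet_u ^ (n - j) * indet_v ^ j)"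
    using k by (simp add: P d_def sum.atLeast_Suc_atMost const2_hom)
  define e where "e j = d j + s * d (j - 1)" for j
  have 1: "indet_u * P = (\<Sum>j=k..Suc n. const2 (d j) * indet_u ^ (Suc n - j) * indet_v ^ j)"
  proof -
    have "indet_u * P = (\<Sum>j=k..n. const2 (d j) * indet_u ^ (Suc n - j) * indet_v ^ j)"
      unfolding P' sum_distrib_left
      by (rule sum.cong) (auto simp: Suc_diff_le mult_ac)
    then show ?thesis using k by (simp add: d_def const2_hom)
  qed
  have 2: "const2 s * indet_v * P
      = (\<Sum>j=Suc k..Suc n. const2 (s * d (j - 1)) * indet_u ^ (Suc n - j) * indet_v ^ j)"
    unfolding P' sum_distrib_left
    by (subst sum.shift_bounds_cl_Suc_ivl) (simp add: const2_hom mult_ac)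
  have "(indet_u + const2 s * indet_v) * P = indet_u * P + const2 s * indet_v * P"
    by (simp add: algebra_simps)
  also have "\<dots> = indet_u ^ (Suc n - k) * indet_v ^ k
      + (\<Sum>j=Suc k..Suc n. const2 (e j) * indet_u ^ (Suc n - j) * indet_v ^ j)"
    unfolding 1 2 e_def using k
    by (subst sum.atLeast_Suc_atMost) (auto simp: d_def const2_hom algebra_simps sum.distrib)
  finally show ?thesis unfolding monic_form_def using k by auto
qed

lemma monic_form_power:
  "monic_form n k P \<Longrightarrow> monic_form (n + p) k ((indet_u + indet_v) ^ p * P)"
proof (induction p)
  case (Suc p)
  then show ?case
    using monic_form_mult_linear[of "n + p" k "(indet_u + indet_v) ^ p * P" 1]
    by (simp add: const2_hom mult.assoc)
qed simp

lemma monic_form_basis: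
  assumes "2 * i \<le> n"
  shows "monic_form n i ((indet_u + indet_v) ^ (n - 2 * i) * (indet_v * (indet_u - indet_v)) ^ i)"
proof -
  have "monic_form (2 * i) i ((indet_v * (indet_u - indet_v)) ^ i)"
  proof (induction i)
    case (Suc i)
    have "const2 (- 1) = - 1" using const2_hom(4)[of 0 1] by (simp add: const2_hom)
    then show ?case
      using monic_form_mult_v[OF monic_form_mult_linear[OF Suc, of "- 1"]]
      by (simp add: mult.assoc)
  qed (simp add: monic_form_one)
  from monic_form_power[OF this, of "n - 2 * i"] show ?thesis using assms by simp
qed

lemma monic_form_dvd:
  assumes "monic_form n k P"
  shows "indet_v ^ k dvd P" "indet_v ^ Suc k dvd P - indet_u ^ (n - k) * indet_v ^ k"
proof -
  show *: "indet_v ^ Suc k dvd P - indet_u ^ (n - k) * indet_v ^ k"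
    using assms unfolding monic_form_def
    by (auto intro!: dvd_sum dvd_mult le_imp_power_dvd simp del: power_Suc)
  then have "indet_v ^ k dvd P - indet_u ^ (n - k) * indet_v ^ k"
    by (rule dvd_trans[rotated]) simp
  then show "indet_v ^ k dvd P"
    using dvd_add[of "indet_v ^ k" "P - indet_u ^ (n - k) * indet_v ^ k"
      "indet_u ^ (n - k) * indet_v ^ k"] by simp
qed

lemma extremal_combination_exists:
  assumes "k \<le> n div 2"
  shows "\<exists>a A. (\<Sum>i\<le>k. const2 (a i) * (indet_u + indet_v) ^ (n - 2 * i)
                          * (indet_v * (indet_u - indet_v)) ^ i)
      = indet_u ^ n + (\<Sum>j=k + 1..n. const2 (A j) * indet_u ^ (n - j) * indet_v ^ j)"
  using assms
proof (induction k)
  case 0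
  have "monic_form n 0 ((indet_u + indet_v) ^ n)" using monic_form_basis[of 0 n] by simp
  then obtain c where "(indet_u + indet_v) ^ n
      = indet_u ^ n + (\<Sum>j=Suc 0..n. const2 (c j) * indet_u ^ (n - j) * indet_v ^ j)"
    by (auto simp: monic_form_def)
  then show ?case by (intro exI[of _ "\<lambda>_. 1"] exI[of _ c]) (simp add: const2_hom)
next
  case (Suc k)
  let ?Q = "\<lambda>i. (indet_u + indet_v) ^ (n - 2 * i) * (indet_v * (indet_u - indet_v)) ^ i"
  let ?M = "\<lambda>j. indet_u ^ (n - j) * indet_v ^ j"
  obtain a A where IH: "(\<Sum>i\<le>k. const2 (a i) * ?Q i)
      = indet_u ^ n + (\<Sum>j=Suc k..n. const2 (A j) * ?M j)"
    using Suc by (auto simp: mult.assoc)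
  obtain c where Q: "?Q (Suc k) = ?M (Suc k) + (\<Sum>j=Suc (Suc k)..n. const2 (c j) * ?M j)"
  proof -
    have "monic_form n (Suc k) (?Q (Suc k))" using Suc.prems by (intro monic_form_basis) auto
    then obtain c where "?Q (Suc k)
        = ?M (Suc k) + (\<Sum>j=Suc (Suc k)..n. const2 (c j) * indet_u ^ (n - j) * indet_v ^ j)"
      unfolding monic_form_def by blast
    then show thesis by (intro that[of c]) (simp only: mult.assoc)
  qed
  define a' where "a' = a(Suc k := - A (Suc k))"
  define B where "B j = A j - A (Suc k) * c j" for j
  have neg: "const2 (- x) = - const2 x" for x
    using const2_hom(4)[of 0 x] by (simp add: const2_hom)
  have "(\<Sum>i\<le>Suc k. const2 (a' i) * ?Q i) = (\<Sum>i\<le>k. const2 (a i) * ?Q i)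
      - const2 (A (Suc k)) * ?Q (Suc k)"
    by (simp add: a'_def neg)
  also have "\<dots> = indet_u ^ n + (\<Sum>j=Suc (Suc k)..n. const2 (B j) * ?M j)"
  proof -
    have "(\<Sum>j=Suc k..n. const2 (A j) * ?M j)
        = const2 (A (Suc k)) * ?M (Suc k) + (\<Sum>j=Suc (Suc k)..n. const2 (A j) * ?M j)"
      using Suc.prems by (intro sum.atLeast_Suc_atMost) auto
    then show ?thesis
      unfolding IH Q B_def
      by (simp add: const2_hom left_diff_distrib sum_subtractf distrib_left sum_distrib_left
          mult.assoc)
  qed
  finally show ?case by (intro exI[of _ a'] exI[of _ B]) (simp add: mult.assoc)
qed

lemma extremal_combination_zero:
  assumes "indet_v ^ (n div 2 + 1) dvd (\<Sum>i\<le>n div 2. const2 (d i) * (indet_u + indet_v) ^ (n - 2 * i)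
                          * (indet_v * (indet_u - indet_v)) ^ i)" "k \<le> n div 2"
  shows "d k = 0"
  using assms(2)
proof (induction k rule: less_induct)
  case (less k)
  let ?Q = "\<lambda>i. (indet_u + indet_v) ^ (n - 2 * i) * (indet_v * (indet_u - indet_v)) ^ i"
  have "(\<Sum>i\<le>n div 2. const2 (d i) * ?Q i)
      = const2 (d k) * ?Q k + (\<Sum>i\<in>{..n div 2} - {k}. const2 (d i) * ?Q i)"
    using less.prems by (intro sum.remove) auto
  moreover have "indet_v ^ Suc k dvd (\<Sum>i\<in>{..n div 2} - {k}. const2 (d i) * ?Q i)"
  proof (rule dvd_sum)
    fix i assume i: "i \<in> {..n div 2} - {k}"
    show "indet_v ^ Suc k dvd const2 (d i) * ?Q i"
    proof (cases "i < k")
      case True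
      then show ?thesis using less.IH[of i] i by (simp add: const2_hom)
    next
      case False
      then have "indet_v ^ Suc k dvd indet_v ^ i" using i by (intro le_imp_power_dvd) auto
      also have "indet_v ^ i dvd ?Q i" using i by (intro monic_form_dvd(1)[OF monic_form_basis]) auto
      finally show ?thesis by (rule dvd_mult)
    qed
  qed
  moreover have "indet_v ^ Suc k dvd (\<Sum>i\<le>n div 2. const2 (d i) * ?Q i)"
    using less.prems assms(1)
    by (intro dvd_trans[OF le_imp_power_dvd[of "Suc k" "n div 2 + 1"]]) (auto simp: mult.assoc)
  ultimately have "indet_v ^ Suc k dvd const2 (d k) * ?Q k"
    by (simp only: dvd_add_left_iff)
  moreover have "indet_v ^ Suc k dvd const2 (d k) * (?Q k - indet_u ^ (n - k) * indet_v ^ k)"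
    using less.prems by (intro dvd_mult monic_form_dvd(2) monic_form_basis) auto
  ultimately have "indet_v ^ Suc k dvd const2 (d k) * ?Q k
      - const2 (d k) * (?Q k - indet_u ^ (n - k) * indet_v ^ k)"
    by (rule dvd_diff)
  then have "indet_v ^ Suc k dvd const2 (d k) * (indet_u ^ (n - k) * indet_v ^ k)"
    by (simp only: right_diff_distrib[symmetric] diff_diff_eq2 add_diff_cancel_left')
  then have "indet_v ^ k * indet_v dvd indet_v ^ k * (const2 (d k) * indet_u ^ (n - k))"
    by (simp add: mult_ac)
  then have "indet_v dvd const2 (d k) * indet_u ^ (n - k)"
    by (subst (asm) dvd_times_left_cancel_iff) (simp_all add: indet_v_def)
  then have "poly (const2 (d k) * indet_u ^ (n - k)) 0 = 0"
    by (metis indet_v_def dvd_iff_poly_eq_0 minus_zero)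
  then show ?case by (simp add: const2_def indet_u_def poly_power)
qed

lemma ex1_extremal_weight_enum: "\<exists>!P. is_extremal_weight_enum n P"
proof (rule ex_ex1I)
  show "\<exists>P. is_extremal_weight_enum n P"
    using extremal_combination_exists[of "n div 2" n] by (auto simp: is_extremal_weight_enum_def)
next
  let ?S = "\<lambda>a. \<Sum>i\<le>n div 2. const2 (a i) * (indet_u + indet_v) ^ (n - 2 * i)
                          * (indet_v * (indet_u - indet_v)) ^ i"
  let ?T = "\<lambda>A. \<Sum>j=n div 2 + 1..n. const2 (A j) * indet_u ^ (n - j) * indet_v ^ j"
  fix P Q
  assume "is_extremal_weight_enum n P" "is_extremal_weight_enum n Q"
  then obtain a A b B where P: "P = ?S a" "P = indet_u ^ n + ?T A"
    and Q: "Q = ?S b" "Q = indet_u ^ n + ?T B"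
    unfolding is_extremal_weight_enum_def by blast
  have "indet_v ^ (n div 2 + 1) dvd ?T X" for X
    by (auto intro!: dvd_sum dvd_mult le_imp_power_dvd simp del: power_Suc)
  then have "indet_v ^ (n div 2 + 1) dvd ?T A - ?T B" by (intro dvd_diff)
  also have "?T A - ?T B = P - Q" unfolding P(2) Q(2) by simp
  also have "P - Q = ?S (\<lambda>i. a i - b i)"
    unfolding P(1) Q(1) by (simp add: const2_hom left_diff_distrib sum_subtractf)
  finally have "a i - b i = 0" if "i \<le> n div 2" for i
    using extremal_combination_zero[where d = "\<lambda>i. a i - b i"] that by blast
  then show "P = Q" unfolding P(1) Q(1) by (intro sum.cong) auto
qed

end

theory Submission
  imports Defs
begin

text \<open>An extremal code has minimum weight greater than \<open>n div 2\<close>, so a self-dual code of this kind meets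
  the Singleton bound or misses it by one. Counting characters, the number of its words supported in
  a set of size \<open>t > n / 2\<close> is \<open>2 ^ (2 * t - n)\<close>; hence the number of words with a given support
  depends only on the size of the support. These numbers must be nonnegative, which leaves
  \<open>n \<in> {1, 2, 3, 4, 5, 6, 7, 9, 11}\<close>; and since the weight is additive modulo 2 on orthogonal words,
  the words of even weight supported in a given set form a subgroup of index at most 2, which excludes
  4, 7, 9 and 11. The lengths 1 and 3 are elementary. For \<open>n = 2\<close> and \<open>n = 6\<close> the code, and for \<open>n = 5\<close>
  the set of its words of even weight, is MDS, hence given by check equations whose coefficients are automorphisms of \<open>K\<close>; these are normalised
  by the action of the symmetry group.\<close>

section \<open>Words and linear codes\<close>

text \<open>The extremal polynomial enters only through its missing coefficients: they give the
  minimum weight condition \<open>optimal_code\<close>, which carries the length bound and the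
  uniqueness and is visibly preserved by equivalence. Conversely, the support counts of such a code
  produce the required gap, and membership in the span of the prescribed products is verified in the
  five surviving lengths. Codes are only closed under addition, so check coefficients are arbitrary
  elements of Aut(K) = S_3 rather than scalars of F_4. After normalisation the minimum weight makes
  the remaining ones fixed point free on nonzero elements, hence 3-cycles; this is how
  multiplication by omega and omega^2 arises. A code of length 5 has 32 words, not a power of 4, so
  it has no systematic form over K; its 16 even words have one, and one odd word is adjoined
  afterwards. In lengths 5 and 6 every optimal code is moved to a standard generator list. The named
  codes are optimal too, so the same result applied to them identifies the list with them.\<close>

lemma klein_add_self [simp]: "x + x = (0 :: klein)"
  by (cases x) (simp_all add: plus_klein_def zero_klein_def)

lemma klein_add_eq_0_iff [simp]: "x + y = 0 \<longleftrightarrow> x = (y :: klein)"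
  by (cases x; cases y) (simp_all add: plus_klein_def zero_klein_def)

lemma klein_add_left [simp]: "x + (x + y) = (y :: klein)"
  by (simp flip: add.assoc)

lemma UNIV_klein: "UNIV = {KO, KA, KB, KC}"
  using klein.exhaust by auto

lemma all_klein: "(\<forall>x. P x) \<longleftrightarrow> P KO \<and> P KA \<and> P KB \<and> P KC"
  by (metis klein.exhaust)

lemma kdot_add: "kdot (x + y) z = kdot x z + kdot y z"
  by (cases x; cases y; cases z) (simp_all add: plus_klein_def zero_klein_def kdot_def)

lemma kdot_commute: "kdot x y = kdot y x"
  by (auto simp: kdot_def)

lemma kdot_0 [simp]: "kdot 0 x = 0" "kdot x 0 = 0"
  by (simp_all add: kdot_def)

lemma carrier_word_group [simp]: "carrier (word_group n) = {x. length x = n}"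
  by (simp add: word_group_def)

lemma mult_word_group [simp]: "x \<otimes>\<^bsub>word_group n\<^esub> y = map2 (+) x y"
  by (simp add: word_group_def)

lemma one_word_group [simp]: "\<one>\<^bsub>word_group n\<^esub> = replicate n 0"
  by (simp add: word_group_def)

lemma nth_map2_add: "length x = n \<Longrightarrow> length y = n \<Longrightarrow> i < n \<Longrightarrow> map2 (+) x y ! i = x ! i + y ! i"
  by simp

lemma word_add_self [simp]: "map2 (+) x x = replicate (length x) (0 :: klein)"
  by (rule nth_equalityI) auto

lemma word_add_0 [simp]:
  "length x = n \<Longrightarrow> map2 (+) x (replicate n (0 :: klein)) = x"
  "length x = n \<Longrightarrow> map2 (+) (replicate n (0 :: klein)) x = x"
  by (auto intro!: nth_equalityI)

lemma word_add_eq_0_iff: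
  assumes "length x = n" "length y = n"
  shows "map2 (+) x y = replicate n (0 :: klein) \<longleftrightarrow> x = y"
  using assms by (auto simp: list_eq_iff_nth_eq)

lemma word_add_cancel:
  assumes "length x = n" "length y = n"
  shows "map2 (+) (map2 (+) x y) y = (x :: klein list)"
  using assms by (auto intro!: nth_equalityI simp: add.assoc)

lemma inv_word_group: "length x = n \<Longrightarrow> inv\<^bsub>word_group n\<^esub> x = x"
  by (rule group.inv_equality[OF group_word_group]) auto

lemma linear_codeI:
  assumes "\<And>x. x \<in> C \<Longrightarrow> length x = n" "replicate n 0 \<in> C"
    and "\<And>x y. x \<in> C \<Longrightarrow> y \<in> C \<Longrightarrow> map2 (+) x y \<in> C"
  shows "linear_code n C"
  unfolding linear_code_def
proof (rule subgroup.intro)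
  show "inv\<^bsub>word_group n\<^esub> x \<in> C" if "x \<in> C" for x
    using that by (simp add: inv_word_group[OF assms(1)])
qed (use assms in auto)

lemma linear_codeD:
  assumes "linear_code n C"
  shows linear_code_length: "x \<in> C \<Longrightarrow> length x = n"
    and linear_code_zero: "replicate n 0 \<in> C"
    and linear_code_add: "x \<in> C \<Longrightarrow> y \<in> C \<Longrightarrow> map2 (+) x y \<in> C"
  using subgroup.subset[of C "word_group n"] subgroup.one_closed[of C "word_group n"]
    subgroup.m_closed[of C "word_group n"] assms
  by (auto simp: linear_code_def)

lemma finite_words: "finite {x :: klein list. length x = n}"
proof -
  have "finite (UNIV :: klein set)" by (simp add: UNIV_klein)
  from finite_lists_length_eq[OF this] show ?thesis by simp
qed

lemma finite_linear_code: "linear_code n C \<Longrightarrow> finite C"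
  by (rule finite_subset[OF _ finite_words[of n]]) (auto dest: linear_code_length)

lemma linear_code_Int: "linear_code n C \<Longrightarrow> linear_code n D \<Longrightarrow> linear_code n (C \<inter> D)"
  by (rule linear_codeI) (auto dest: linear_codeD)

text \<open>Translation by \<open>t\<close> exchanges the words with and without \<open>h\<close>,
  because \<open>h\<close> behaves like a homomorphism to a group of order 2. Used for character
  sums and for words of even weight.\<close>

lemma card_index_two:
  assumes "linear_code n C" "\<And>x y. x \<in> C \<Longrightarrow> y \<in> C \<Longrightarrow> h (map2 (+) x y) \<longleftrightarrow> (h x \<longleftrightarrow> h y)"
    and "t \<in> C" "\<not> h t"
  shows "card {x \<in> C. \<not> h x} = card {x \<in> C. h x}" "2 * card {x \<in> C. h x} = card C"
proof -
  note len = linear_code_length[OF assms(1)] and add = linear_code_add[OF assms(1)]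
  have "bij_betw (\<lambda>x. map2 (+) x t) {x \<in> C. \<not> h x} {x \<in> C. h x}"
    by (rule bij_betw_byWitness[where f' = "\<lambda>x. map2 (+) x t"])
      (use assms(2-) in \<open>auto simp: len add intro!: word_add_cancel[of _ n]\<close>)
  then show *: "card {x \<in> C. \<not> h x} = card {x \<in> C. h x}" by (rule bij_betw_same_card)
  have "card C = card {x \<in> C. h x} + card {x \<in> C. \<not> h x}"
    using finite_linear_code[OF assms(1)]
    by (subst card_Un_disjoint[symmetric]) (auto intro: arg_cong[where f = card])
  then show "2 * card {x \<in> C. h x} = card C" using * by simp
qed

section \<open>Duality\<close>

lemma word_inner_commute: "word_inner n x y = word_inner n y x"
  by (simp add: word_inner_def kdot_commute)

lemma word_inner_add:
  "length x = n \<Longrightarrow> length y = n \<Longrightarrow>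
    word_inner n (map2 (+) x y) z = word_inner n x z + word_inner n y z"
  unfolding word_inner_def sum.distrib[symmetric] by (intro sum.cong) (simp_all add: kdot_add)

lemma word_inner_0 [simp]: "word_inner n (replicate n 0) y = 0"
  by (simp add: word_inner_def)

lemma linear_code_dual_code: "linear_code n (dual_code n C)"
  by (rule linear_codeI) (auto simp: dual_code_def word_inner_add)

text \<open>Double counting of a character sum over \<open>C\<close> and \<open>D\<close>: summing
  over \<open>C\<close> first leaves \<open>card C\<close> for each \<open>y\<close> in
  \<open>D\<close> orthogonal to \<open>C\<close> and 0 for every other \<open>y\<close>; the other
  order is symmetric.\<close>

lemma card_dual_code_Int:
  assumes C: "linear_code n C" and D: "linear_code n D"
  shows "card C * card (dual_code n C \<inter> D) = card D * card (C \<inter> dual_code n D)"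
proof -
  define \<chi> :: "klein list \<Rightarrow> klein list \<Rightarrow> int"
    where "\<chi> x y = (if word_inner n x y = 0 then 1 else - 1)" for x y
  have *: "(\<Sum>x\<in>A. \<chi> x y) = (if y \<in> dual_code n A then int (card A) else 0)"
    if A: "linear_code n A" and y: "length y = n" for A y
  proof (cases "y \<in> dual_code n A")
    case True
    then have "\<chi> x y = 1" if "x \<in> A" for x
      using that by (simp add: \<chi>_def dual_code_def word_inner_commute)
    then show ?thesis using True by simp
  next
    case False
    then obtain t where t: "t \<in> A" "word_inner n t y \<noteq> 0"
      using y by (auto simp: dual_code_def word_inner_commute)
    have add: "word_inner n (map2 (+) x x') y = 0 \<longleftrightarrow> (word_inner n x y = 0 \<longleftrightarrow> word_inner n x' y = 0)"
      if "x \<in> A" "x' \<in> A" for x x'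
      using that by (cases "word_inner n x y"; cases "word_inner n x' y")
        (simp_all add: word_inner_add linear_code_length[OF A])
    have "(\<Sum>x\<in>A. \<chi> x y) = int (card {x \<in> A. word_inner n x y = 0})
        - int (card {x \<in> A. word_inner n x y \<noteq> 0})"
      unfolding \<chi>_def by (subst sum.If_cases)
        (auto simp: finite_linear_code[OF A] Int_def intro!: arg_cong[where f = card])
    also have "\<dots> = 0"
      using card_index_two(1)[OF A, of "\<lambda>x. word_inner n x y = 0", OF add t] by simp
    finally show ?thesis using False by simp
  qed
  have sums: "(\<Sum>y\<in>B. if y \<in> E then int k else 0) = int (k * card (E \<inter> B))" if "finite B" for B E k
    using that by (simp add: sum.If_cases Int_def conj_commute)
  have "(\<Sum>y\<in>D. \<Sum>x\<in>C. \<chi> x y) = int (card C * card (dual_code n C \<inter> D))"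
    using sums[of D "dual_code n C" "card C"] finite_linear_code[OF D] *[OF C] linear_code_length[OF D] by simp
  moreover have "(\<Sum>x\<in>C. \<Sum>y\<in>D. \<chi> y x) = int (card D * card (dual_code n D \<inter> C))"
    using sums[of C "dual_code n D" "card D"] finite_linear_code[OF C] *[OF D] linear_code_length[OF C] by simp
  moreover have "(\<Sum>y\<in>D. \<Sum>x\<in>C. \<chi> x y) = (\<Sum>x\<in>C. \<Sum>y\<in>D. \<chi> y x)"
    by (subst sum.swap) (simp add: \<chi>_def word_inner_commute)
  ultimately show ?thesis by (simp only: of_nat_eq_iff Int_commute)
qed

section \<open>Supports, and the code of all words supported in a set\<close>

definition supp :: "klein list \<Rightarrow> nat set" where
  "supp x = {i. i < length x \<and> x ! i \<noteq> 0}"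

definition words_on :: "nat \<Rightarrow> nat set \<Rightarrow> klein list set" where
  "words_on n S = {x. length x = n \<and> supp x \<subseteq> S}"

lemma wt_eq_card_supp: "wt x = card (supp x)"
  by (simp add: wt_def supp_def)

lemma supp_subset: "length x = n \<Longrightarrow> supp x \<subseteq> {..<n}"
  by (auto simp: supp_def)

lemma finite_supp [simp]: "finite (supp x)"
  by (simp add: supp_def)

lemma wt_le: "length x = n \<Longrightarrow> wt x \<le> n"
  using card_mono[OF _ supp_subset[of x n]] by (simp add: wt_eq_card_supp)

lemma supp_eq_empty_iff: "length x = n \<Longrightarrow> supp x = {} \<longleftrightarrow> x = replicate n 0"
  by (auto simp: supp_def list_eq_iff_nth_eq)

lemma wt_eq_0_iff: "length x = n \<Longrightarrow> wt x = 0 \<longleftrightarrow> x = replicate n 0"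
  by (simp add: wt_eq_card_supp supp_eq_empty_iff)

lemma linear_code_words_on: "linear_code n (words_on n S)"
  by (rule linear_codeI) (auto simp: words_on_def supp_def subset_iff)

lemma card_words_on:
  assumes "S \<subseteq> {..<n}"
  shows "card (words_on n S) = 4 ^ card S"
proof -
  have "bij_betw (\<lambda>x. \<lambda>i\<in>S. x ! i) (words_on n S) (S \<rightarrow>\<^sub>E UNIV)"
    by (rule bij_betw_byWitness[where f' = "\<lambda>f. map (\<lambda>i. if i \<in> S then f i else 0) [0..<n]"])
      (use assms in \<open>auto simp: words_on_def supp_def fun_eq_iff subset_iff PiE_def extensional_def
        intro!: nth_equalityI split: if_splits\<close>)
  then have "card (words_on n S) = card (S \<rightarrow>\<^sub>E (UNIV :: klein set))" by (rule bij_betw_same_card)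
  also have "\<dots> = 4 ^ card S"
    using finite_subset[OF assms] by (simp add: card_PiE UNIV_klein numeral_eq_Suc)
  finally show ?thesis .
qed

lemma klein_nondegenerate: "(x :: klein) \<noteq> 0 \<Longrightarrow> \<exists>v. kdot x v = 1"
  by (cases x) (auto simp: kdot_def zero_klein_def intro: exI[of _ KA] exI[of _ KB])

lemma dual_code_words_on: "dual_code n (words_on n S) = words_on n ({..<n} - S)"
proof (intro equalityI subsetI)
  fix x assume x: "x \<in> dual_code n (words_on n S)"
  then have len: "length x = n" by (simp add: dual_code_def)
  have "i \<notin> S" if i: "i \<in> supp x" for i
  proof
    assume "i \<in> S"
    have i': "i < n" "x ! i \<noteq> 0" using i len by (auto simp: supp_def)
    then obtain v where v: "kdot (x ! i) v = 1" using klein_nondegenerate by blast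
    \<comment> \<open>The only nonzero entry is at \<open>i\<close>, so the inner product with
      \<open>x\<close> reduces to \<open>kdot (x ! i) v = 1\<close>.\<close>
    let ?y = "(replicate n 0)[i := v]"
    have "?y \<in> words_on n S"
      using \<open>i \<in> S\<close> by (auto simp: words_on_def supp_def nth_list_update split: if_splits)
        (metis nth_list_update_neq nth_replicate)
    then have "word_inner n x ?y = 0" using x by (simp add: dual_code_def)
    moreover have "word_inner n x ?y = (\<Sum>j<n. if j = i then 1 else 0)"
      unfolding word_inner_def using i' v by (intro sum.cong) (auto simp: nth_list_update)
    ultimately show False using i' by simp
  qed
  then show "x \<in> words_on n ({..<n} - S)" using len by (auto simp: words_on_def supp_def)
next
  fix x assume x: "x \<in> words_on n ({..<n} - S)"
  have "word_inner n x y = 0" if "y \<in> words_on n S" for y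
    unfolding word_inner_def
  proof (rule sum.neutral, intro ballI)
    fix i assume "i \<in> {..<n}"
    then have "x ! i = 0 \<or> y ! i = 0" using x that by (auto simp: words_on_def supp_def subset_iff)
    then show "kdot (x ! i) (y ! i) = 0" by auto
  qed
  then show "x \<in> dual_code n (words_on n S)" using x by (auto simp: words_on_def dual_code_def)
qed

text \<open>The double counting identity with \<open>D\<close> the full word space, whose dual is
  the zero code.\<close>

lemma card_dual_code:
  assumes "linear_code n C"
  shows "card C * card (dual_code n C) = 4 ^ n"
proof -
  have "dual_code n C \<inter> words_on n {..<n} = dual_code n C"
    by (auto simp: dual_code_def words_on_def supp_def)
  moreover have "C \<inter> words_on n {} = {replicate n 0}"
    using linear_codeD[OF assms] by (auto simp: words_on_def supp_eq_empty_iff)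
  ultimately show ?thesis
    using card_dual_code_Int[OF assms linear_code_words_on, of "{..<n}"]
    by (simp add: card_words_on dual_code_words_on)
qed

definition self_orthogonal :: "nat \<Rightarrow> klein list set \<Rightarrow> bool" where
  "self_orthogonal n C \<longleftrightarrow> (\<forall>x\<in>C. \<forall>y\<in>C. word_inner n x y = 0)"

lemma self_dual_iff:
  "self_dual n C \<longleftrightarrow> linear_code n C \<and> self_orthogonal n C \<and> card C = 2 ^ n"
proof (intro iffI conjI)
  assume *: "self_dual n C"
  then show lin: "linear_code n C" by (simp add: self_dual_def)
  show "self_orthogonal n C" using * by (auto simp: self_dual_def dual_code_def self_orthogonal_def)
  have "card C ^ 2 = (2 ^ n) ^ 2"
    using card_dual_code[OF lin] * by (simp add: self_dual_def power2_eq_square flip: power_mult_distrib)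
  then show "card C = 2 ^ n" by (simp add: power2_eq_iff_nonneg)
next
  assume *: "linear_code n C \<and> self_orthogonal n C \<and> card C = 2 ^ n"
  then have "2 ^ n * card (dual_code n C) = 2 ^ n * 2 ^ n"
    using card_dual_code[of n C] by (simp flip: power_mult_distrib)
  then have "card (dual_code n C) = card C" using * by simp
  moreover have "C \<subseteq> dual_code n C"
    using * linear_code_length[of n C] by (auto simp: dual_code_def self_orthogonal_def)
  ultimately have "C = dual_code n C"
    using card_subset_eq[of "dual_code n C" C] finite_linear_code[OF linear_code_dual_code] by simp
  then show "self_dual n C" using * by (simp add: self_dual_def)
qed

section \<open>Weight distribution\<close>

definition optimal_code :: "nat \<Rightarrow> klein list set \<Rightarrow> bool" where
  "optimal_code n C \<longleftrightarrow> self_dual n C \<and> (\<forall>x\<in>C. x \<noteq> replicate n 0 \<longrightarrow> n div 2 < wt x)"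

lemma optimal_codeD:
  assumes "optimal_code n C"
  shows "linear_code n C" "self_orthogonal n C" "card C = 2 ^ n" "C = dual_code n C"
    and "x \<in> C \<Longrightarrow> x \<noteq> replicate n 0 \<Longrightarrow> n div 2 < wt x"
  using assms self_dual_iff[of n C] unfolding optimal_code_def self_dual_def by blast+

text \<open>The complement of \<open>T\<close> has at most n/2 elements and so carries no nonzero
  codeword. As \<open>C\<close> is its own dual, double counting against the words on this
  complement reads \<open>2 ^ n = 4 ^ (n - card T) * card (C \<inter> words_on n T)\<close>.\<close>

lemma card_optimal_code_words_on:
  assumes C: "optimal_code n C" and T: "T \<subseteq> {..<n}" "n div 2 < card T"
  shows "card (C \<inter> words_on n T) = 2 ^ (2 * card T - n)"
proof -
  note lin = optimal_codeD(1)[OF C]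
  let ?S = "{..<n} - T"
  have fin: "finite T" using T(1) by (rule finite_subset) simp
  have le: "card T \<le> n" using card_mono[OF _ T(1)] by simp
  have card_S: "card ?S = n - card T"
    using T(1) fin by (simp add: card_Diff_subset)
  have "C \<inter> words_on n ?S = {replicate n 0}"
  proof (intro equalityI subsetI)
    fix x :: "klein list" assume x: "x \<in> C \<inter> words_on n ?S"
    then have "wt x \<le> card ?S"
      unfolding wt_eq_card_supp by (intro card_mono) (auto simp: words_on_def)
    also have "\<dots> \<le> n div 2" using T(2) le unfolding card_S by linarith
    finally show "x \<in> {replicate n 0}" using optimal_codeD(5)[OF C, of x] x by auto
  next
    fix x :: "klein list" assume "x \<in> {replicate n 0}"
    then show "x \<in> C \<inter> words_on n ?S"
      using linear_code_zero[OF lin] linear_code_zero[OF linear_code_words_on] by auto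
  qed
  then have "2 ^ n * 1 = 4 ^ card ?S * card (C \<inter> words_on n T)"
    using card_dual_code_Int[OF lin linear_code_words_on, of ?S] T(1) optimal_codeD(3,4)[OF C]
    by (simp add: card_words_on dual_code_words_on double_diff)
  also have "4 ^ card ?S = (2 :: nat) ^ (2 * card ?S)" by (simp add: power_mult)
  also have "(2 :: nat) ^ n = 2 ^ (2 * card ?S) * 2 ^ (2 * card T - n)"
    using T(2) le unfolding power_add[symmetric] card_S by (intro arg_cong2[where f = power]) auto
  finally show ?thesis by simp
qed

lemma sum_Pow_card:
  fixes g :: "nat \<Rightarrow> 'b :: comm_semiring_1"
  assumes "finite T"
  shows "(\<Sum>U\<in>Pow T. g (card U)) = (\<Sum>j\<le>card T. of_nat (card T choose j) * g j)"
proof -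
  have "(\<Sum>U\<in>Pow T. g (card U)) = (\<Sum>j\<le>card T. \<Sum>U\<in>{U \<in> Pow T. card U = j}. g (card U))"
    using assms by (intro sum.group[symmetric]) (auto intro: card_mono)
  also have "\<dots> = (\<Sum>j\<le>card T. of_nat (card T choose j) * g j)"
    using n_subsets[OF assms] by (intro sum.cong) auto
  finally show ?thesis .
qed

text \<open>The number of words of an optimal code of length \<open>n\<close> with a prescribed support of size \<open>t\<close>:
  inclusion-exclusion from \<open>2 ^ (2 * t - n)\<close>, the number of words supported in a given
  set of size \<open>t > n / 2\<close>.\<close>

fun support_count :: "nat \<Rightarrow> nat \<Rightarrow> int" where
  "support_count n t = (if t = 0 then 1 else if t \<le> n div 2 then 0
     else 2 ^ (2 * t - n) - (\<Sum>j<t. int (t choose j) * support_count n j))"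

declare support_count.simps [simp del]

lemma card_filter_words_on:
  assumes "finite C" "T \<subseteq> {..<n}"
  shows "int (card {x \<in> C \<inter> words_on n T. P (wt x)})
    = (\<Sum>U\<in>Pow T. if P (card U) then int (card {x \<in> C \<inter> words_on n T. supp x = U}) else 0)"
proof -
  let ?A = "{x \<in> C \<inter> words_on n T. P (wt x)}"
  have fin: "finite (Pow T)" "finite ?A" using assms by (auto intro: finite_subset)
  have "int (card ?A) = (\<Sum>U\<in>Pow T. \<Sum>x\<in>{x \<in> ?A. supp x = U}. 1)"
    using fin by (subst sum.group) (auto simp: words_on_def)
  also have "\<dots> = (\<Sum>U\<in>Pow T. if P (card U) then int (card {x \<in> C \<inter> words_on n T. supp x = U}) else 0)"
    by (intro sum.cong refl) (auto simp: wt_eq_card_supp card_eq_0_iff intro!: arg_cong[where f = card])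
  finally show ?thesis .
qed

text \<open>Strong induction on the size of \<open>T\<close>: the codewords inside \<open>T\<close>
  split by their exact support, and the proper subsets are already counted.\<close>

lemma support_count:
  assumes C: "optimal_code n C" and "T \<subseteq> {..<n}"
  shows "int (card {x \<in> C. supp x = T}) = support_count n (card T)"
  using assms(2)
proof (induction "card T" arbitrary: T rule: less_induct)
  case less
  have fin: "finite T" using less.prems by (rule finite_subset) simp
  note lin = optimal_codeD(1)[OF C]
  note len = linear_code_length[OF lin]
  consider "T = {}" | "T \<noteq> {}" "card T \<le> n div 2" | "n div 2 < card T" by linarith
  then show ?case
  proof cases
    case 1
    have "{x \<in> C. supp x = {}} = {replicate n 0}"
      using linear_code_zero[OF lin] len by (auto simp: supp_eq_empty_iff)
    then show ?thesis using 1 by (simp add: support_count.simps)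
  next
    case 2
    have "{x \<in> C. supp x = T} = {}"
    proof (rule equals0I)
      fix x assume "x \<in> {x \<in> C. supp x = T}"
      then have x: "x \<in> C" "supp x = T" by auto
      then have "x \<noteq> replicate n 0" using 2 len supp_eq_empty_iff by blast
      then show False using optimal_codeD(5)[OF C x(1)] x 2 by (simp add: wt_eq_card_supp)
    qed
    then have "card {x \<in> C. supp x = T} = 0" by (simp only: card.empty)
    then show ?thesis using 2 fin by (simp add: support_count.simps)
  next
    case 3
    have eq: "{x \<in> C \<inter> words_on n T. supp x = U} = {x \<in> C. supp x = U}" if "U \<subseteq> T" for U
      using that len by (auto simp: words_on_def)
    have "2 ^ (2 * card T - n) = int (card {x \<in> C \<inter> words_on n T. True})"
      using card_optimal_code_words_on[OF C less.prems 3] by (simp add: Collect_conj_eq)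
    also have "\<dots> = (\<Sum>U\<in>Pow T. int (card {x \<in> C. supp x = U}))"
      unfolding card_filter_words_on[OF finite_linear_code[OF lin] less.prems, where P = "\<lambda>_. True"]
      by (intro sum.cong) (simp_all add: eq del: Int_iff)
    also have "\<dots> = int (card {x \<in> C. supp x = T}) + (\<Sum>U\<in>Pow T - {T}. int (card {x \<in> C. supp x = U}))"
      using fin by (intro sum.remove) auto
    also have "(\<Sum>U\<in>Pow T - {T}. int (card {x \<in> C. supp x = U}))
        = (\<Sum>U\<in>Pow T - {T}. support_count n (card U))"
      using less fin by (intro sum.cong refl less.hyps psubset_card_mono) auto
    also have "\<dots> = (\<Sum>U\<in>Pow T. support_count n (card U)) - support_count n (card T)"
      using fin by (subst sum.remove[of "Pow T" T]) auto
    also have "(\<Sum>U\<in>Pow T. support_count n (card U))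
        = (\<Sum>j<card T. int (card T choose j) * support_count n j) + support_count n (card T)"
      unfolding sum_Pow_card[OF fin] lessThan_Suc_atMost[symmetric] by simp
    finally show ?thesis using 3 by (subst support_count.simps) auto
  qed
qed

lemma card_optimal_code_filter:
  assumes C: "optimal_code n C" and T: "T \<subseteq> {..<n}"
  shows "int (card {x \<in> C \<inter> words_on n T. P (wt x)})
    = (\<Sum>j\<le>card T. if P j then int (card T choose j) * support_count n j else 0)"
proof -
  note lin = optimal_codeD(1)[OF C]
  have "int (card {x \<in> C \<inter> words_on n T. P (wt x)})
      = (\<Sum>U\<in>Pow T. if P (card U) then support_count n (card U) else 0)"
    unfolding card_filter_words_on[OF finite_linear_code[OF lin] T]
    using T linear_code_length[OF lin]
    by (intro sum.cong refl if_cong) (auto simp: words_on_def simp flip: support_count[OF C]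
        intro!: arg_cong[where f = card])
  also have "\<dots> = (\<Sum>j\<le>card T. int (card T choose j) * (if P j then support_count n j else 0))"
    using T by (intro sum_Pow_card) (auto intro: finite_subset)
  finally show ?thesis by (simp add: if_distrib cong: if_cong)
qed

text \<open>Sizes from 1 to n/2 contribute nothing, so just above n/2 the recursion has very few
  terms besides the 1 of the zero word.\<close>

lemma sum_support_count:
  assumes "n div 2 < t"
  shows "(\<Sum>j<t. int (t choose j) * support_count n j)
    = 1 + (\<Sum>j\<in>{n div 2<..<t}. int (t choose j) * support_count n j)"
proof -
  have "(\<Sum>j<t. int (t choose j) * support_count n j)
      = (\<Sum>j\<in>insert 0 {n div 2<..<t}. int (t choose j) * support_count n j)"
    using assms by (intro sum.mono_neutral_right) (auto simp: support_count.simps)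
  also have "\<dots> = 1 + (\<Sum>j\<in>{n div 2<..<t}. int (t choose j) * support_count n j)"
    by (subst sum.insert) (auto simp: support_count.simps)
  finally show ?thesis .
qed

lemma support_count_Suc_half:
  "support_count n (Suc (n div 2)) = (if even n then 3 else 1)"
proof -
  have "{n div 2<..<Suc (n div 2)} = {}" by auto
  then show ?thesis by (subst support_count.simps, subst sum_support_count) (auto simp: Suc_diff_le)
qed

text \<open>The values are \<open>2^4 - 1 - 3 (h + 2)\<close> for n = 2h and
  \<open>2^3 - 1 - (h + 2)\<close> for n = 2h + 1. They turn negative for even n > 6 and odd n > 11,
  which bounds the length.\<close>

lemma support_count_Suc_Suc_half:
  "support_count n (Suc (Suc (n div 2))) =
     (if even n then 9 - 3 * int (n div 2) else 5 - int (n div 2))"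
proof -
  have "{n div 2<..<Suc (Suc (n div 2))} = {Suc (n div 2)}" by auto
  then show ?thesis
    by (subst support_count.simps, subst sum_support_count)
      (auto simp: support_count_Suc_half Suc_diff_le)
qed

section \<open>Parity of weights and the possible lengths\<close>

text \<open>With \<open>K\<close> as the plane over F_2 with coordinates s, t, the indicator of
  nonzero elements is the quadratic form s^2 + s t + t^2, and \<open>kdot\<close> is its polar
  form.\<close>

lemma klein_parity: "of_bool (x + y \<noteq> 0) = of_bool (x \<noteq> 0) + of_bool (y \<noteq> 0) + kdot x y"
  by (cases x; cases y) (simp_all add: plus_klein_def zero_klein_def kdot_def)

lemma even_wt_iff:
  assumes "length x = n"
  shows "even (wt x) \<longleftrightarrow> (\<Sum>i<n. of_bool (x ! i \<noteq> 0)) = (0 :: bit)"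
proof -
  have "(\<Sum>i<n. of_bool (x ! i \<noteq> 0)) = (of_nat (wt x) :: bit)"
    using assms by (simp add: wt_def lessThan_def Collect_conj_eq)
  also have "\<dots> = 0 \<longleftrightarrow> even (wt x)" by (cases "even (wt x)") (auto elim!: evenE oddE)
  finally show ?thesis by simp
qed

lemma even_wt_add:
  assumes "length x = n" "length y = n" "word_inner n x y = 0"
  shows "even (wt (map2 (+) x y)) \<longleftrightarrow> (even (wt x) \<longleftrightarrow> even (wt y))"
proof -
  have "(\<Sum>i<n. of_bool (map2 (+) x y ! i \<noteq> 0))
     = (\<Sum>i<n. of_bool (x ! i \<noteq> 0)) + (\<Sum>i<n. of_bool (y ! i \<noteq> 0)) + word_inner n x y"
    unfolding word_inner_def sum.distrib[symmetric]
    using assms by (intro sum.cong) (simp_all only: lessThan_iff klein_parity[symmetric] nth_map2_add)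
  moreover have "a + b = 0 \<longleftrightarrow> (a = 0 \<longleftrightarrow> b = 0)" for a b :: bit
    by (cases a; cases b) simp_all
  moreover have "length (map2 (+) x y) = n" using assms by simp
  ultimately show ?thesis
    using assms by (simp only: even_wt_iff[of _ n] add_0_right)
qed

lemma even_words_dichotomy:
  assumes D: "linear_code n D" "self_orthogonal n D"
  shows "card {x \<in> D. even (wt x)} = card D \<or> 2 * card {x \<in> D. even (wt x)} = card D"
proof (cases "\<forall>x\<in>D. even (wt x)")
  case True
  then have "{x \<in> D. even (wt x)} = D" by auto
  then show ?thesis by simp
next
  case False
  then obtain t where "t \<in> D" "odd (wt t)" by auto
  then show ?thesis
    using D card_index_two(2)[OF D(1), of "\<lambda>x. even (wt x)" t]
    by (simp add: even_wt_add[of _ n] linear_code_length[OF D(1)] self_orthogonal_def)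
qed

lemma sum_even_support_count:
  assumes C: "optimal_code n C" and t: "n div 2 < t" "t \<le> n"
  defines "s \<equiv> (\<Sum>j\<le>t. if even j then int (t choose j) * support_count n j else 0)"
  shows "s = 2 ^ (2 * t - n) \<or> 2 * s = 2 ^ (2 * t - n)"
proof -
  let ?D = "C \<inter> words_on n {..<t}"
  have "linear_code n ?D" "self_orthogonal n ?D"
    using linear_code_Int[OF optimal_codeD(1)[OF C] linear_code_words_on] optimal_codeD(2)[OF C]
    by (auto simp: self_orthogonal_def)
  from even_words_dichotomy[OF this]
  have "int (card {x \<in> ?D. even (wt x)}) = int (card ?D) \<or>
      2 * int (card {x \<in> ?D. even (wt x)}) = int (card ?D)" by linarith
  then show ?thesis
    using card_optimal_code_words_on[OF C, of "{..<t}"] t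
      card_optimal_code_filter[OF C, of "{..<t}" even]
    by (simp add: s_def del: Int_iff cong: if_cong)
qed

text \<open>The totals \<open>2 ^ (2 * t - n)\<close> to compare with are 16, 32, 8, 8 and 128 in
  this order. Only the value for length 5 is the total or half of it; that value is also the size of
  the MDS subcode in length 5.\<close>

lemma even_counts:
  "(\<Sum>j\<le>4. if even j then int (4 choose j) * support_count 4 j else 0) = 4"
  "(\<Sum>j\<le>5. if even j then int (5 choose j) * support_count 5 j else 0) = 16"
  "(\<Sum>j\<le>5. if even j then int (5 choose j) * support_count 7 j else 0) = 6"
  "(\<Sum>j\<le>6. if even j then int (6 choose j) * support_count 9 j else 0) = 2"
  "(\<Sum>j\<le>9. if even j then int (9 choose j) * support_count 11 j else 0) = 112"
  by code_simp+

lemma optimal_code_length: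
  assumes C: "optimal_code n C" and "n \<ge> 1"
  shows "n \<in> {1, 2, 3, 5, 6}"
proof -
  have "0 \<le> support_count n t" if "t \<le> n" for t
    using support_count[OF C, of "{..<t}"] that by simp
  \<comment> \<open>For n = 1 and n = 2 this size exceeds n and nothing is learnt, but both lengths
    are in the list. From n = 3 on the count must be nonnegative.\<close>
  from this[of "Suc (Suc (n div 2))"] have "n \<in> {1, 2, 3, 4, 5, 6, 7, 9, 11}"
    using \<open>n \<ge> 1\<close> unfolding support_count_Suc_Suc_half by (cases "even n") (auto elim!: evenE oddE)
  moreover have "n \<noteq> 4" using sum_even_support_count[of 4 C 4] C by (auto simp: even_counts)
  moreover have "n \<noteq> 7" using sum_even_support_count[of 7 C 5] C by (auto simp: even_counts)
  moreover have "n \<noteq> 9" using sum_even_support_count[of 9 C 6] C by (auto simp: even_counts)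
  moreover have "n \<noteq> 11" using sum_even_support_count[of 11 C 9] C by (auto simp: even_counts)
  ultimately show ?thesis by auto
qed

section \<open>Extremality\<close>

lemma indet_monomial: "indet_u ^ a * indet_v ^ b = monom ([:0, 1:] ^ a) b"
proof -
  have "indet_u ^ a = [:[:0, 1:] ^ a:]"
    by (induction a) (simp_all add: indet_u_def one_pCons)
  moreover have "indet_v ^ b = monom 1 b"
    by (induction b) (simp_all add: indet_v_def monom_Suc monom_0)
  ultimately show ?thesis by (simp add: smult_monom)
qed

lemma coeff_const2_monomial:
  "coeff (const2 c * indet_u ^ a * indet_v ^ b) j = (if j = b then smult c ([:0, 1:] ^ a) else 0)"
  by (auto simp: mult.assoc indet_monomial const2_def)

lemma weight_enum_eq:
  assumes "linear_code n C"
  shows "weight_enum n C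
    = (\<Sum>j\<le>n. const2 (real (card {x \<in> C. wt x = j})) * indet_u ^ (n - j) * indet_v ^ j)"
proof -
  have "weight_enum n C = (\<Sum>j\<le>n. \<Sum>x\<in>{x \<in> C. wt x = j}. indet_u ^ (n - wt x) * indet_v ^ wt x)"
    unfolding weight_enum_def
    using finite_linear_code[OF assms] wt_le linear_code_length[OF assms]
    by (intro sum.group[symmetric]) auto
  also have "\<dots> = (\<Sum>j\<le>n. const2 (real (card {x \<in> C. wt x = j})) * indet_u ^ (n - j) * indet_v ^ j)"
    by (intro sum.cong refl) (simp add: const2_def of_nat_poly mult.assoc)
  finally show ?thesis .
qed

lemma is_extremal_weight_enum_extremal: "is_extremal_weight_enum n (extremal_weight_enum n)"
  unfolding extremal_weight_enum_def by (rule theI'[OF ex1_extremal_weight_enum])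

lemma extremal_weight_enum_eqI: "is_extremal_weight_enum n P \<Longrightarrow> extremal_weight_enum n = P"
  unfolding extremal_weight_enum_def by (rule the1_equality[OF ex1_extremal_weight_enum])

text \<open>A nonzero word of weight at most n/2 would make the coefficient at its weight a positive
  count, whereas the extremal polynomial vanishes there.\<close>

lemma extremal_imp_optimal:
  assumes "extremal_code n C"
  shows "optimal_code n C"
proof -
  have sd: "self_dual n C" and P: "is_extremal_weight_enum n (weight_enum n C)"
    using assms is_extremal_weight_enum_extremal by (simp_all add: extremal_code_def)
  have lin: "linear_code n C" using sd by (simp add: self_dual_def)
  have "n div 2 < wt x" if x: "x \<in> C" "x \<noteq> replicate n 0" for x
  proof (rule ccontr)
    let ?i = "wt x"
    assume "\<not> n div 2 < ?i"
    moreover have "?i \<noteq> 0" using x wt_eq_0_iff linear_code_length[OF lin] by blast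
    ultimately have i: "?i \<noteq> 0" "?i \<le> n div 2" "?i \<le> n" by auto
    obtain A where "weight_enum n C
        = const2 1 * indet_u ^ n * indet_v ^ 0
          + (\<Sum>j=n div 2 + 1..n. const2 (A j) * indet_u ^ (n - j) * indet_v ^ j)"
      using P unfolding is_extremal_weight_enum_def by (auto simp: const2_hom)
    then have "coeff (weight_enum n C) ?i = 0"
      using i by (simp only: coeff_add coeff_sum coeff_const2_monomial) (auto intro!: sum.neutral)
    moreover have "coeff (weight_enum n C) ?i = smult (real (card {y \<in> C. wt y = ?i})) ([:0, 1:] ^ (n - ?i))"
      using i unfolding weight_enum_eq[OF lin] coeff_sum coeff_const2_monomial by simp
    ultimately have "card {y \<in> C. wt y = ?i} = 0" by simp
    then show False using x finite_linear_code[OF lin] by auto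
  qed
  then show ?thesis using sd by (simp add: optimal_code_def)
qed

text \<open>Supplies the second clause of \<open>is_extremal_weight_enum\<close> in every length;
  only the representation by the prescribed products then remains.\<close>

lemma weight_enum_optimal_code:
  assumes C: "optimal_code n C"
  shows "weight_enum n C = indet_u ^ n
    + (\<Sum>j=n div 2 + 1..n. const2 (of_int (int (n choose j) * support_count n j))
        * indet_u ^ (n - j) * indet_v ^ j)"
proof -
  note lin = optimal_codeD(1)[OF C]
  let ?c = "\<lambda>j. int (n choose j) * support_count n j"
  let ?m = "\<lambda>j. const2 (of_int (?c j)) * indet_u ^ (n - j) * indet_v ^ j"
  have eq: "C \<inter> words_on n {..<n} = C"
    using linear_code_length[OF lin] supp_subset by (auto simp: words_on_def)
  have "int (card {x \<in> C. wt x = j}) = ?c j" if "j \<le> n" for j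
    using card_optimal_code_filter[OF C, of "{..<n}" "\<lambda>i. i = j"] that by (simp add: eq)
  then have "real (card {x \<in> C. wt x = j}) = of_int (?c j)" if "j \<le> n" for j
    using that by (metis of_int_of_nat_eq)
  then have "weight_enum n C = (\<Sum>j\<le>n. ?m j)"
    unfolding weight_enum_eq[OF lin] by (intro sum.cong) auto
  also have "\<dots> = (\<Sum>j\<in>insert 0 {n div 2 + 1..n}. ?m j)"
    by (intro sum.mono_neutral_right) (auto simp: support_count.simps const2_hom)
  also have "\<dots> = indet_u ^ n + (\<Sum>j=n div 2 + 1..n. ?m j)"
    by (subst sum.insert) (auto simp: support_count.simps const2_hom)
  finally show ?thesis .
qed

lemma const2_simps [simp]:
  "const2 0 = 0" "const2 1 = 1" "const2 (- x) = - const2 x" "const2 (numeral k) = numeral k"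
  by (simp_all add: const2_def numeral_poly one_pCons)

lemma weight_counts:
  "support_count 1 1 = 1"
  "support_count 2 2 = 3"
  "int (3 choose 2) * support_count 3 2 = 3" "support_count 3 3 = 4"
  "int (5 choose 3) * support_count 5 3 = 10" "int (5 choose 4) * support_count 5 4 = 15"
  "support_count 5 5 = 6"
  "int (6 choose 4) * support_count 6 4 = 45" "int (6 choose 5) * support_count 6 5 = 0"
  "support_count 6 6 = 18"
  by code_simp+

text \<open>The coefficients come from clearing \<open>u^(n-1) v\<close>,
  \<open>u^(n-2) v^2\<close>, ... in turn, starting from \<open>(u + v) ^ n\<close>; the first
  correction is always -n, and in length 5 the second is 0. They reappear as the witness lists of
  the next proof.\<close>

lemma extremal_polynomials:
  fixes u v :: "'a :: comm_ring_1"
  shows "u ^ 2 + 3 * v ^ 2 = (u + v) ^ 2 - 2 * (v * (u - v))"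
    and "u ^ 3 + (3 * u * v ^ 2 + 4 * v ^ 3) = (u + v) ^ 3 - 3 * (u + v) * (v * (u - v))"
    and "u ^ 5 + (10 * u ^ 2 * v ^ 3 + (15 * u * v ^ 4 + 6 * v ^ 5))
      = (u + v) ^ 5 - 5 * (u + v) ^ 3 * (v * (u - v))"
    and "u ^ 6 + (45 * u ^ 2 * v ^ 4 + 18 * v ^ 6)
      = (u + v) ^ 6 + (3 * (u + v) ^ 2 * (v * (u - v)) ^ 2 - 8 * (v * (u - v)) ^ 3
        - 6 * (u + v) ^ 4 * (v * (u - v)))"
  by (simp_all add: eval_nat_numeral algebra_simps)

lemma optimal_imp_extremal:
  assumes C: "optimal_code n C" and n: "n \<in> {1, 2, 3, 5, 6}"
  shows "extremal_code n C"
proof -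
  define P where "P = weight_enum n C"
  note P = weight_enum_optimal_code[OF C, folded P_def]
  have "\<exists>a. P = (\<Sum>i\<le>n div 2. const2 (a i) * (indet_u + indet_v) ^ (n - 2 * i)
                          * (indet_v * (indet_u - indet_v)) ^ i)"
  proof -
    consider "n = 1" | "n = 2" | "n = 3" | "n = 5" | "n = 6" using n by auto
    then show ?thesis
    proof cases
      case 1
      have sets: "{..1 div 2 :: nat} = {0}" "{1 div 2 + 1..1 :: nat} = {1}" by auto
      show ?thesis unfolding P 1 sets
        by (intro exI[of _ "\<lambda>i. 1"]) (simp add: weight_counts[simplified])
    next
      case 2
      have sets: "{..2 div 2 :: nat} = {0, 1}" "{2 div 2 + 1..2 :: nat} = {2}" by auto
      show ?thesis unfolding P 2 sets
        by (intro exI[of _ "(!) [1, - 2]"])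
          (simp add: weight_counts extremal_polynomials del: of_int_mult)
    next
      case 3
      have sets: "{..3 div 2 :: nat} = {0, 1}" "{3 div 2 + 1..3 :: nat} = {2, 3}" by auto
      show ?thesis unfolding P 3 sets
        by (intro exI[of _ "(!) [1, - 3]"])
          (simp add: weight_counts extremal_polynomials del: of_int_mult, simp add: algebra_simps)
    next
      case 4
      have sets: "{..5 div 2 :: nat} = {0, 1, 2}" "{5 div 2 + 1..5 :: nat} = {3, 4, 5}" by auto
      show ?thesis unfolding P 4 sets
        by (intro exI[of _ "(!) [1, - 5, 0]"])
          (simp add: weight_counts extremal_polynomials del: of_int_mult)
    next
      case 5
      have sets: "{..6 div 2 :: nat} = {0, 1, 2, 3}" "{6 div 2 + 1..6 :: nat} = {4, 5, 6}" by auto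
      show ?thesis unfolding P 5 sets
        by (intro exI[of _ "(!) [1, - 6, 3, - 8]"])
          (simp add: weight_counts extremal_polynomials del: of_int_mult)
    qed
  qed
  then have "is_extremal_weight_enum n P"
    unfolding is_extremal_weight_enum_def using P
    by (elim exE) (intro exI conjI)
  then show ?thesis
    using C unfolding extremal_code_def optimal_code_def P_def by (simp add: extremal_weight_enum_eqI)
qed

section \<open>Equivalence\<close>

lemma optimal_codeI:
  assumes "linear_code n C" "self_orthogonal n C" "card C = 2 ^ n"
    and "\<And>x. x \<in> C \<Longrightarrow> x \<noteq> replicate n 0 \<Longrightarrow> n div 2 < wt x"
  shows "optimal_code n C"
  using assms by (simp add: optimal_code_def self_dual_iff)

lemma klein_permD:
  assumes "\<sigma> permutes {KA, KB, KC}"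
  shows "\<sigma> KO = KO" "(\<sigma> KA, \<sigma> KB, \<sigma> KC) \<in>
    {(KA, KB, KC), (KA, KC, KB), (KB, KA, KC), (KB, KC, KA), (KC, KA, KB), (KC, KB, KA)}"
proof -
  show "\<sigma> KO = KO" using assms by (rule permutes_not_in) simp
  have "\<sigma> x \<in> {KA, KB, KC} \<longleftrightarrow> x \<in> {KA, KB, KC}" for x
    using assms by (rule permutes_in_image)
  from this[of KA] this[of KB] this[of KC]
  have "\<sigma> KA \<noteq> KO" "\<sigma> KB \<noteq> KO" "\<sigma> KC \<noteq> KO" by auto
  moreover have "\<sigma> KA \<noteq> \<sigma> KB" "\<sigma> KA \<noteq> \<sigma> KC" "\<sigma> KB \<noteq> \<sigma> KC"
    by (simp_all only: inj_eq[OF permutes_inj[OF assms]] klein.distinct not_False_eq_True)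
  ultimately show "(\<sigma> KA, \<sigma> KB, \<sigma> KC) \<in>
    {(KA, KB, KC), (KA, KC, KB), (KB, KA, KC), (KB, KC, KA), (KC, KA, KB), (KC, KB, KA)}"
    by (cases "\<sigma> KA"; cases "\<sigma> KB"; cases "\<sigma> KC") simp_all
qed

text \<open>Two distinct nonzero elements add up to the third, so every permutation of the three is
  additive: S_3 is the automorphism group of \<open>K\<close>.\<close>

lemma klein_perm_add:
  assumes "\<sigma> permutes {KA, KB, KC}"
  shows "\<sigma> (x + y) = \<sigma> x + \<sigma> y"
  using klein_permD[OF assms]
  by (cases x; cases y) (auto simp: plus_klein_def zero_klein_def)

lemma klein_perm_eq_0_iff:
  assumes "\<sigma> permutes {KA, KB, KC}"
  shows "\<sigma> x = 0 \<longleftrightarrow> x = 0"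
  using klein_permD[OF assms] by (cases x) (auto simp: zero_klein_def)

lemma klein_perm_sum:
  assumes "\<sigma> permutes {KA, KB, KC}"
  shows "\<sigma> (\<Sum>j\<in>A. f j) = (\<Sum>j\<in>A. \<sigma> (f j))"
  by (induction A rule: infinite_finite_induct)
    (simp_all add: klein_perm_add[OF assms] klein_perm_eq_0_iff[OF assms])

text \<open>Conversely, an endomorphism with trivial kernel is such a permutation. This is how check
  coefficients are recognised as elements of S_3.\<close>

lemma klein_permI:
  assumes add: "\<And>x y. f (x + y) = f x + f y" and 0: "\<And>x. f x = 0 \<Longrightarrow> x = 0"
  shows "f permutes {KA, KB, KC}"
proof -
  have "x = y" if "f x = f y" for x y
    using 0[of "x + y"] add[of x y] that by simp
  then have "inj f" by (rule injI)
  moreover have "finite (UNIV :: klein set)" by (simp add: UNIV_klein)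
  ultimately have "bij f" by (simp add: bij_def finite_UNIV_inj_surj)
  moreover have "f KO = KO" using add[of 0 0] by (simp add: zero_klein_def[symmetric])
  then have "f x = x" if "x \<notin> {KA, KB, KC}" for x using that by (cases x) auto
  ultimately show ?thesis by (simp add: permutes_def bij_iff)
qed

lemma kdot_klein_perm:
  assumes "\<sigma> permutes {KA, KB, KC}"
  shows "kdot (\<sigma> x) (\<sigma> y) = kdot x y"
  by (simp add: kdot_def klein_perm_eq_0_iff[OF assms] inj_eq[OF permutes_inj[OF assms]])

lemma length_act_word [simp]: "length (act_word g x) = length x"
  by (simp add: act_word_def)

lemma nth_act_word [simp]: "i < length x \<Longrightarrow> act_word g x ! i = snd g i (x ! fst g i)"
  by (simp add: act_word_def)

lemma wt_act_word:
  assumes g: "g \<in> sym_pairs n" and len: "length x = n"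
  shows "wt (act_word g x) = wt x"
proof -
  obtain \<pi> \<sigma> where g_eq: "g = (\<pi>, \<sigma>)" by (cases g)
  note \<pi> = sym_pairsD(1)[OF g[unfolded g_eq]] and \<sigma> = sym_pairsD(2)[OF g[unfolded g_eq]]
  have lt: "\<pi> i < n" if "i < n" for i
    using that permutes_in_image[OF \<pi>, of i] by auto
  have "bij_betw \<pi> {i. i < n \<and> act_word g x ! i \<noteq> 0} {i. i < n \<and> x ! i \<noteq> 0}"
    by (rule bij_betw_byWitness[where f' = "inv_into UNIV \<pi>"])
      (use len lt permutes_inverses[OF \<pi>] permutes_in_image[OF permutes_inv[OF \<pi>]]
       in \<open>auto simp: g_eq klein_perm_eq_0_iff[OF \<sigma>]\<close>)
  from bij_betw_same_card[OF this] show ?thesis using len by (simp add: wt_def)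
qed

lemma optimal_code_act:
  assumes C: "optimal_code n C" and g: "g \<in> sym_pairs n"
  shows "optimal_code n (act_word g ` C)" "((n, C), (n, act_word g ` C)) \<in> code_equiv"
proof -
  note lin = optimal_codeD(1)[OF C]
  note len = linear_code_length[OF lin]
  obtain \<pi> \<sigma> where g_eq: "g = (\<pi>, \<sigma>)" by (cases g)
  note \<pi> = sym_pairsD(1)[OF g[unfolded g_eq]] and \<sigma> = sym_pairsD(2)[OF g[unfolded g_eq]]
  have lt: "\<pi> i < n" if "i < n" for i
    using that permutes_in_image[OF \<pi>, of i] by auto
  note wt = wt_act_word[OF g len]
  have add: "act_word g (map2 (+) x y) = map2 (+) (act_word g x) (act_word g y)"
    if "x \<in> C" "y \<in> C" for x y
    using len that lt by (auto simp: g_eq klein_perm_add[OF \<sigma>] intro!: nth_equalityI)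
  have zero: "act_word g x = replicate n 0 \<longleftrightarrow> x = replicate n 0" if "x \<in> C" for x
    using wt[OF that] wt_eq_0_iff[of x n] wt_eq_0_iff[of "act_word g x" n] len[OF that] by simp
  have inner: "word_inner n (act_word g x) (act_word g y) = word_inner n x y"
    if "x \<in> C" "y \<in> C" for x y
  proof -
    have "word_inner n (act_word g x) (act_word g y) = (\<Sum>i<n. kdot (x ! \<pi> i) (y ! \<pi> i))"
      unfolding word_inner_def using len that \<sigma> by (intro sum.cong) (auto simp: g_eq kdot_klein_perm)
    also have "\<dots> = word_inner n x y"
      unfolding word_inner_def using sum.permute[OF \<pi>, of "\<lambda>i. kdot (x ! i) (y ! i)"] by (simp add: o_def)
    finally show ?thesis .
  qed
  \<comment> \<open>Weights are preserved, so only the zero word is sent to zero; additivity does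
    the rest.\<close>
  have "inj_on (act_word g) C"
  proof (rule inj_onI)
    fix x y assume *: "x \<in> C" "y \<in> C" "act_word g x = act_word g y"
    then have "act_word g (map2 (+) x y) = replicate n 0" using len add by simp
    then have "map2 (+) x y = replicate n 0"
      using zero linear_code_add[OF lin *(1,2)] by blast
    then show "x = y" using word_add_eq_0_iff[of x n y] len * by simp
  qed
  then have card: "card (act_word g ` C) = 2 ^ n"
    using optimal_codeD(3)[OF C] by (simp add: card_image)
  have lin': "linear_code n (act_word g ` C)"
  proof (rule linear_codeI)
    show "replicate n 0 \<in> act_word g ` C"
      using zero[of "replicate n 0"] linear_code_zero[OF lin] by (intro image_eqI[of _ _ "replicate n 0"]) simp_all
  qed (use len linear_code_add[OF lin] in \<open>auto simp flip: add\<close>)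
  show "optimal_code n (act_word g ` C)"
    using optimal_codeD(2,5)[OF C] lin' card
    by (intro optimal_codeI) (auto simp: self_orthogonal_def inner wt zero)
  show "((n, C), (n, act_word g ` C)) \<in> code_equiv"
    using lin lin' g by (auto simp: code_equiv_def)
qed

section \<open>Generated codes\<close>

text \<open>All subset sums of the generators, repetitions included, so that distinctness of the
  list expresses independence over F_2 and can be evaluated.\<close>

fun span_list :: "nat \<Rightarrow> klein list list \<Rightarrow> klein list list" where
  "span_list n [] = [replicate n 0]"
| "span_list n (g # gs) = span_list n gs @ map (map2 (+) g) (span_list n gs)"

lemma length_span_list [simp]: "length (span_list n gs) = 2 ^ length gs"
  by (induction gs) auto

lemma linear_code_span_list:
  assumes "\<forall>g\<in>set gs. length g = n"
  shows "linear_code n (set (span_list n gs)) \<and> set gs \<subseteq> set (span_list n gs)"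
  using assms
proof (induction gs)
  case Nil
  have "linear_code n (set (span_list n []))" by (rule linear_codeI) auto
  then show ?case by simp
next
  case (Cons g gs)
  let ?S = "set (span_list n gs)"
  have lin: "linear_code n ?S" and sub: "set gs \<subseteq> ?S" and g: "length g = n" using Cons by auto
  note len = linear_code_length[OF lin]
  have "linear_code n (set (span_list n (g # gs)))"
  proof (rule linear_codeI)
    fix x y assume xy: "x \<in> set (span_list n (g # gs))" "y \<in> set (span_list n (g # gs))"
    obtain a x' where x: "x' \<in> ?S" "x = (if a then map2 (+) g x' else x')"
      using xy(1) by (auto intro: that[of _ True] that[of _ False])
    obtain b y' where y: "y' \<in> ?S" "y = (if b then map2 (+) g y' else y')"
      using xy(2) by (auto intro: that[of _ True] that[of _ False])
    show "length x = n" using x len[of x'] g by simp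
    have "map2 (+) x y = (if a = b then map2 (+) x' y' else map2 (+) g (map2 (+) x' y'))"
      using x(2) y(2) len[OF x(1)] len[OF y(1)] g
      by (cases a; cases b) (simp_all add: list_eq_iff_nth_eq add_ac klein_add_left)
    moreover have "map2 (+) x' y' \<in> ?S" using x(1) y(1) by (rule linear_code_add[OF lin])
    ultimately show "map2 (+) x y \<in> set (span_list n (g # gs))" by (cases "a = b") simp_all
  qed (use linear_code_zero[OF lin] in simp)
  moreover have "set (g # gs) \<subseteq> set (span_list n (g # gs))"
    using sub g linear_code_zero[OF lin] by (auto intro: image_eqI[of _ _ "replicate n 0"])
  ultimately show ?case by blast
qed

lemma generate_eq_span_list:
  assumes "\<forall>g\<in>set gs. length g = n"
  shows "generate (word_group n) (set gs) = set (span_list n gs)"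
proof (rule group.generateI[OF group_word_group, symmetric])
  show "subgroup (set (span_list n gs)) (word_group n)" "set gs \<subseteq> set (span_list n gs)"
    using linear_code_span_list[OF assms] by (simp_all add: linear_code_def)
  fix K assume K: "subgroup K (word_group n)" "set gs \<subseteq> K"
  then have "linear_code n K" by (simp add: linear_code_def)
  from linear_code_zero[OF this] linear_code_add[OF this] K(2)
  show "set (span_list n gs) \<subseteq> K" by (induction gs) auto
qed

text \<open>Independent words \<open>gs\<close>, n in number, already generate \<open>2 ^ n\<close>
  words, the size of \<open>C\<close>. Uniqueness proofs therefore only have to place the standard
  generators inside a transformed code.\<close>

lemma optimal_code_eq_generate:
  assumes "optimal_code n C" "set gs \<subseteq> C" "length gs = n" "distinct (span_list n gs)"
  shows "C = generate (word_group n) (set gs)"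
proof -
  note lin = optimal_codeD(1)[OF assms(1)]
  have len: "\<forall>g\<in>set gs. length g = n" using assms(2) linear_code_length[OF lin] by auto
  have "generate (word_group n) (set gs) \<subseteq> C"
    using group.generate_subgroup_incl[OF group_word_group assms(2)] lin by (simp add: linear_code_def)
  moreover have "card (generate (word_group n) (set gs)) = card C"
    using optimal_codeD(3)[OF assms(1)] assms(3,4)
    by (simp add: generate_eq_span_list[OF len] distinct_card)
  ultimately show ?thesis using card_subset_eq[OF finite_linear_code[OF lin]] by metis
qed

text \<open>A dual code is a subgroup, so it contains the generated code once it contains the
  generators. Using this twice, with the symmetry of the inner product in between, extends
  orthogonality from generators to the whole code. The remaining conditions are finite
  evaluations.\<close>

lemma optimal_code_generate:
  assumes len: "\<forall>g\<in>set gs. length g = n" and "length gs = n" "distinct (span_list n gs)"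
    and orth: "\<forall>g\<in>set gs. \<forall>h\<in>set gs. word_inner n g h = 0"
    and wt: "\<forall>x\<in>set (span_list n gs). x = replicate n 0 \<or> n div 2 < wt x"
  shows "optimal_code n (generate (word_group n) (set gs))"
proof -
  let ?G = "generate (word_group n) (set gs)"
  have incl: "?G \<subseteq> dual_code n A" if "set gs \<subseteq> dual_code n A" for A
    using group.generate_subgroup_incl[OF group_word_group that] linear_code_dual_code
    by (simp add: linear_code_def)
  have "set gs \<subseteq> dual_code n (set gs)" using len orth by (auto simp: dual_code_def)
  then have "?G \<subseteq> dual_code n (set gs)" by (rule incl)
  then have "set gs \<subseteq> dual_code n ?G"
    using len word_inner_commute by (fastforce simp: dual_code_def)
  then have "?G \<subseteq> dual_code n ?G" by (rule incl)
  then have "self_orthogonal n ?G" by (auto simp: self_orthogonal_def dual_code_def)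
  then show ?thesis
    using assms linear_code_span_list[OF len]
    by (intro optimal_codeI) (auto simp: generate_eq_span_list[OF len] distinct_card)
qed

lemma wt_eq_length_filter: "wt x = length (filter (\<lambda>a. a \<noteq> 0) x)"
  by (simp add: wt_def length_filter_conv_card)

lemma wt_Nil [simp]: "wt [] = 0"
  by (simp add: wt_def)

lemma wt_Cons [simp]: "wt (x # xs) = (if x = 0 then wt xs else Suc (wt xs))"
  by (simp add: wt_eq_length_filter)

lemma word_inner_Nil [simp]: "word_inner 0 x y = 0"
  by (simp add: word_inner_def)

lemma word_inner_Cons [simp]:
  "word_inner (Suc n) (x # xs) (y # ys) = kdot x y + word_inner n xs ys"
  unfolding word_inner_def by (subst sum.lessThan_Suc_shift) simp

lemmas [code] = wt_Nil wt_Cons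


section \<open>The five named codes\<close>

lemma gamma1_eq: "gamma1 = generate (word_group 1) (set [[KA]])"
proof -
  have "gamma1 = set (span_list 1 [[KA]])" by code_simp
  also have "\<dots> = generate (word_group 1) (set [[KA]])"
    by (rule generate_eq_span_list[symmetric]) simp
  finally show ?thesis .
qed

lemma epsilon2_eq: "epsilon2 = generate (word_group 2) (set [[KA, KA], [KB, KB]])"
proof -
  have "epsilon2 = set (span_list 2 [[KA, KA], [KB, KB]])" by code_simp
  also have "\<dots> = generate (word_group 2) (set [[KA, KA], [KB, KB]])"
    by (rule generate_eq_span_list[symmetric]) simp
  finally show ?thesis .
qed

abbreviation "delta3_gens \<equiv> [[KA, KA, KO], [KO, KA, KA], [KB, KB, KB]]"

abbreviation "hexacode_gens \<equiv>
    [[KA, KO, KA, KO, KB, KB],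
     [KA, KO, KB, KB, KA, KO],
     [KB, KB, KA, KO, KA, KO],
     [KO, KO, KA, KA, KA, KA],
     [KA, KA, KO, KO, KA, KA],
     [KB, KO, KB, KO, KC, KA]]"

text \<open>The first, second, fourth and fifth hexacode generators, and the sum of the third and
  sixth (which both begin with \<open>KB\<close>), each with the first coordinate deleted.\<close>

abbreviation "shorter_hexacode_gens \<equiv>
    [[KO, KA, KO, KB, KB],
     [KO, KB, KB, KA, KO],
     [KO, KA, KA, KA, KA],
     [KA, KO, KO, KA, KA],
     [KB, KC, KO, KB, KA]]"

lemma delta3_plus_eq: "delta3_plus = generate (word_group 3) (set delta3_gens)"
  by (simp add: delta3_plus_def)

lemma hexacode_eq: "hexacode = generate (word_group 6) (set hexacode_gens)"
  by (simp add: hexacode_def)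

lemma shorter_hexacode_eq:
  "shorter_hexacode = generate (word_group 5) (set shorter_hexacode_gens)"
proof -
  have "hexacode = set (span_list 6 hexacode_gens)"
    unfolding hexacode_eq by (rule generate_eq_span_list) simp
  \<comment> \<open>Turns the comprehension into an image of a filtered set, which can be evaluated
    on a list.\<close>
  moreover have "{tl x | x. x \<in> H \<and> hd x \<in> {KO, KA}} = tl ` Set.filter (\<lambda>x. hd x \<in> {KO, KA}) H"
    for H :: "klein list set" by (auto simp: image_iff)
  ultimately have "shorter_hexacode
      = tl ` Set.filter (\<lambda>x. hd x \<in> {KO, KA}) (set (span_list 6 hexacode_gens))"
    unfolding shorter_hexacode_def by (simp only:)
  also have "\<dots> = set (span_list 5 shorter_hexacode_gens)" by code_simp
  also have "\<dots> = generate (word_group 5) (set shorter_hexacode_gens)"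
    by (rule generate_eq_span_list[symmetric]) simp
  finally show ?thesis .
qed

lemma optimal_codes:
  "optimal_code 1 gamma1" "optimal_code 2 epsilon2" "optimal_code 3 delta3_plus"
  "optimal_code 5 shorter_hexacode" "optimal_code 6 hexacode"
proof -
  show "optimal_code 1 gamma1"
    unfolding gamma1_eq by (rule optimal_code_generate; code_simp)
  show "optimal_code 2 epsilon2"
    unfolding epsilon2_eq by (rule optimal_code_generate; code_simp)
  show "optimal_code 3 delta3_plus"
    unfolding delta3_plus_eq by (rule optimal_code_generate; code_simp)
  show "optimal_code 5 shorter_hexacode"
    unfolding shorter_hexacode_eq by (rule optimal_code_generate; code_simp)
  show "optimal_code 6 hexacode"
    unfolding hexacode_eq by (rule optimal_code_generate; code_simp)
qed

section \<open>Uniqueness\<close>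

definition systematic_code :: "nat \<Rightarrow> nat \<Rightarrow> (nat \<Rightarrow> nat \<Rightarrow> klein \<Rightarrow> klein) \<Rightarrow> klein list set" where
  "systematic_code n k m = {x. length x = n \<and> (\<forall>i\<in>{k..<n}. x ! i = (\<Sum>j<k. m i j (x ! j)))}"

text \<open>A codeword vanishing on the first k coordinates has weight at most n - k, hence is zero;
  by counting, these coordinates determine the word and take all values. The inverse
  \<open>E\<close> is additive, so each check coordinate is a sum of additive functions of the
  single entries. Each of these has trivial kernel: otherwise encoding a single nonzero entry would
  lose one of the n - k check coordinates and leave weight at most n - k.\<close>

lemma MDS_systematic:
  assumes lin: "linear_code n C" and card: "card C = 4 ^ k" and k: "k < n"
    and wt: "\<And>x. x \<in> C \<Longrightarrow> x \<noteq> replicate n 0 \<Longrightarrow> n - k < wt x"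
  obtains m where "\<And>i j. i \<in> {k..<n} \<Longrightarrow> j < k \<Longrightarrow> m i j permutes {KA, KB, KC}"
    and "C = systematic_code n k m"
proof -
  note len = linear_code_length[OF lin] and add = linear_code_add[OF lin]
  have inj: "inj_on (take k) C"
  proof (rule inj_onI)
    fix x y assume xy: "x \<in> C" "y \<in> C" "take k x = take k y"
    let ?z = "map2 (+) x y"
    have "x ! i = y ! i" if "i < k" for i
      using arg_cong[OF xy(3), of "\<lambda>l. l ! i"] that by simp
    then have "supp ?z \<subseteq> {k..<n}" using len xy by (auto simp: supp_def not_less[symmetric])
    then have "wt ?z \<le> n - k"
      using card_mono[of "{k..<n}" "supp ?z"] by (simp add: wt_eq_card_supp)
    then have "?z = replicate n 0" using wt[of ?z] add[OF xy(1,2)] by fastforce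
    then show "x = y" using word_add_eq_0_iff[of x n y] len xy by simp
  qed
  have "words_on k {..<k} = {p. length p = k}" by (auto simp: words_on_def supp_def)
  then have "card {p :: klein list. length p = k} = 4 ^ k" using card_words_on[of "{..<k}" k] by simp
  moreover have "take k ` C \<subseteq> {p. length p = k}" using len k by auto
  ultimately have surj: "take k ` C = {p. length p = k}"
    using card_subset_eq[OF finite_words] card_image[OF inj] card by metis
  define E where "E = inv_into C (take k)"
  have E: "E p \<in> C" "take k (E p) = p" if "length p = k" for p
    using that surj inv_into_into[of p "take k" C] f_inv_into_f[of p "take k" C]
    by (auto simp: E_def)
  have E_take: "E (take k x) = x" if "x \<in> C" for x
    using inv_into_f_f[OF inj that] by (simp add: E_def)
  have E_len: "length (E p) = n" if "length p = k" for p using E(1)[OF that] len by blast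
  have E_add: "E (map2 (+) p q) = map2 (+) (E p) (E q)" if "length p = k" "length q = k" for p q
  proof -
    have "take k (map2 (+) (E p) (E q)) = map2 (+) p q"
      using E that by (simp add: take_map take_zip)
    then show ?thesis using E_take[OF add[OF E(1)[OF that(1)] E(1)[OF that(2)]]] by simp
  qed
  have E_0: "E (replicate k 0) = replicate n 0"
    using E_add[of "replicate k 0" "replicate k 0"] E_len[of "replicate k 0"] by simp
  \<comment> \<open>For \<open>j \<ge> k\<close> the update is void and \<open>e j v\<close> is the
    zero word, so length and additivity hold for every \<open>j\<close>.\<close>
  define e where "e j v = (replicate k 0)[j := v :: klein]" for j v
  have e_len: "length (e j v) = k" for j v by (simp add: e_def)
  have e_add: "e j (v + w) = map2 (+) (e j v) (e j w)" for j v w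
    by (cases "j < k") (auto simp: e_def list_eq_iff_nth_eq nth_list_update)
  define m where "m i j v = E (e j v) ! i" for i j v
  have m: "m i j permutes {KA, KB, KC}" if ij: "i \<in> {k..<n}" "j < k" for i j
  proof (rule klein_permI)
    show "m i j (v + w) = m i j v + m i j w" for v w
      using ij E_len[OF e_len] by (simp add: m_def e_add E_add[OF e_len e_len])
    fix v assume v: "m i j v = 0"
    show "v = 0"
    proof (rule ccontr)
      assume "v \<noteq> 0"
      let ?x = "E (e j v)"
      have nth: "?x ! l = e j v ! l" if "l < k" for l
        using that E(2)[OF e_len, of j v] by (metis nth_take)
      then have "?x ! j \<noteq> 0" using ij \<open>v \<noteq> 0\<close> by (simp add: e_def)
      then have "?x \<noteq> replicate n 0" using ij k by auto
      then have "n - k < wt ?x" using wt E(1)[OF e_len] by blast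
      also have "supp ?x \<subseteq> insert j ({k..<n} - {i})"
        using v E_len[OF e_len, of j v] nth
        by (auto simp: supp_def m_def e_def nth_list_update not_less[symmetric] split: if_splits)
      then have "wt ?x \<le> card (insert j ({k..<n} - {i}))"
        unfolding wt_eq_card_supp by (intro card_mono) auto
      also have "\<dots> = n - k" using ij by auto
      finally show False by simp
    qed
  qed
  have E_nth: "E p ! i = (\<Sum>j<k. m i j (p ! j))" if p: "length p = k" and i: "i < n" for p i
  proof -
    \<comment> \<open>Builds \<open>p\<close> from the zero word one coordinate at a time, by adding
      \<open>e l (p ! l)\<close>.\<close>
    have "l \<le> k \<Longrightarrow> E (take l p @ replicate (k - l) 0) ! i = (\<Sum>j<l. m i j (p ! j))" for l
    proof (induction l)
      case 0
      then show ?case using i by (simp add: E_0)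
    next
      case (Suc l)
      have "take (Suc l) p @ replicate (k - Suc l) 0 = map2 (+) (take l p @ replicate (k - l) 0) (e l (p ! l))"
        using Suc.prems p by (auto simp: list_eq_iff_nth_eq e_def nth_append nth_list_update less_Suc_eq)
      then have "E (take (Suc l) p @ replicate (k - Suc l) 0)
          = map2 (+) (E (take l p @ replicate (k - l) 0)) (E (e l (p ! l)))"
        using Suc.prems p by (simp add: E_add e_len)
      then show ?case
        using Suc p i E_len[of "take l p @ replicate (k - l) 0"] E_len[OF e_len] by (simp add: m_def)
    qed
    from this[of k] show ?thesis using p by simp
  qed
  have "C = systematic_code n k m"
  proof (intro equalityI subsetI)
    fix x assume x: "x \<in> C"
    have "x ! i = (\<Sum>j<k. m i j (x ! j))" if "i < n" for i
      using E_nth[of "take k x" i] E_take[OF x] that k len[OF x] by simp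
    then show "x \<in> systematic_code n k m" using len[OF x] by (simp add: systematic_code_def)
  next
    fix x assume x: "x \<in> systematic_code n k m"
    then have tk: "length (take k x) = k" using k by (simp add: systematic_code_def)
    have "E (take k x) ! i = x ! i" if "i < n" for i
    proof (cases "i < k")
      case True
      then show ?thesis using E(2)[OF tk] by (metis nth_take)
    next
      case False
      then show ?thesis using E_nth[OF tk that] x that by (simp add: systematic_code_def)
    qed
    then have "E (take k x) = x"
      using E_len[OF tk] x by (intro nth_equalityI) (simp_all add: systematic_code_def)
    then show "x \<in> C" using E(1)[OF tk] by simp
  qed
  with m that show thesis by blast
qed

text \<open>The analogue of scaling rows and columns of a generator matrix until its first check
  column and first row consist of ones; scalars are replaced by elements of S_3, so the order of
  composition matters.\<close>

lemma MDS_normal_form: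
  assumes lin: "linear_code n C" and card: "card C = 4 ^ k" and k: "k < n" "0 < k"
    and wt: "\<And>x. x \<in> C \<Longrightarrow> x \<noteq> replicate n 0 \<Longrightarrow> n - k < wt x"
  obtains \<sigma> m where "(id, \<sigma>) \<in> sym_pairs n"
    and "\<And>i j. i \<in> {k..<n} \<Longrightarrow> j < k \<Longrightarrow> m i j permutes {KA, KB, KC}"
    and "\<And>j. j < k \<Longrightarrow> m k j = id" "\<And>i. i \<in> {k..<n} \<Longrightarrow> m i 0 = id"
    and "act_word (id, \<sigma>) ` C = systematic_code n k m"
proof -
  obtain m where m: "\<And>i j. i \<in> {k..<n} \<Longrightarrow> j < k \<Longrightarrow> m i j permutes {KA, KB, KC}"
    and C: "C = systematic_code n k m"
    using MDS_systematic[OF lin card k(1) wt] by blast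
  \<comment> \<open>An action by \<open>\<sigma>\<close> changes \<open>m i j\<close> into
    \<sigma>_i m_ij \<sigma>_j^(-1). The choice makes \<sigma>_0 the identity, the coefficients at
    \<open>j = 0\<close> trivial through the check coordinates, and those at \<open>i = k\<close>
    trivial through the information coordinates.\<close>
  define \<sigma> where "\<sigma> i = (if i < k then inv_into UNIV (m k 0) \<circ> m k i else inv_into UNIV (m i 0))" for i
  have \<sigma>: "\<sigma> i permutes {KA, KB, KC}" if "i < n" for i
    using that m k by (auto simp: \<sigma>_def intro!: permutes_inv permutes_compose)
  define m' where "m' i j = \<sigma> i \<circ> m i j \<circ> inv_into UNIV (\<sigma> j)" for i j
  have m': "m' i j permutes {KA, KB, KC}" if "i \<in> {k..<n}" "j < k" for i j
    using that m \<sigma> by (auto simp: m'_def intro!: permutes_inv permutes_compose)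
  have "m' k j = id" if "j < k" for j
    using permutes_inv_o(1)[OF \<sigma>[of j]] that k by (simp add: m'_def \<sigma>_def)
  moreover have \<sigma>_0: "\<sigma> 0 = id" using permutes_inv_o(2)[OF m[of k 0]] k by (simp add: \<sigma>_def)
  have "m' i 0 = id" if "i \<in> {k..<n}" for i
    using permutes_inv_o(2)[OF m[of i 0]] that k by (simp add: m'_def \<sigma>_0) (simp add: \<sigma>_def)
  moreover have "act_word (id, \<sigma>) ` C = systematic_code n k m'"
  proof (intro equalityI subsetI)
    fix y assume "y \<in> act_word (id, \<sigma>) ` C"
    then obtain x where x: "x \<in> C" "y = act_word (id, \<sigma>) x" by auto
    then have len: "length x = n" "length y = n" by (simp_all add: C systematic_code_def)
    have "y ! i = (\<Sum>j<k. m' i j (y ! j))" if i: "i \<in> {k..<n}" for i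
    proof -
      have "y ! i = \<sigma> i (\<Sum>j<k. m i j (x ! j))"
        using x i len by (simp add: C systematic_code_def)
      also have "\<dots> = (\<Sum>j<k. \<sigma> i (m i j (x ! j)))"
        using i by (intro klein_perm_sum \<sigma>) simp
      also have "\<dots> = (\<Sum>j<k. m' i j (y ! j))"
        using x len k by (intro sum.cong refl) (simp add: m'_def permutes_inverses(2)[OF \<sigma>])
      finally show ?thesis .
    qed
    then show "y \<in> systematic_code n k m'" using len by (simp add: systematic_code_def)
  next
    fix y assume y: "y \<in> systematic_code n k m'"
    then have len: "length y = n" by (simp add: systematic_code_def)
    define x where "x = map (\<lambda>i. inv_into UNIV (\<sigma> i) (y ! i)) [0..<n]"
    have "x ! i = (\<Sum>j<k. m i j (x ! j))" if i: "i \<in> {k..<n}" for i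
    proof -
      have "x ! i = inv_into UNIV (\<sigma> i) (\<Sum>j<k. m' i j (y ! j))"
        using y i by (simp add: x_def systematic_code_def)
      also have "\<dots> = (\<Sum>j<k. inv_into UNIV (\<sigma> i) (m' i j (y ! j)))"
        using i by (intro klein_perm_sum permutes_inv \<sigma>) simp
      also have "\<dots> = (\<Sum>j<k. m i j (x ! j))"
        using i k by (intro sum.cong refl) (simp add: m'_def x_def permutes_inverses(2)[OF \<sigma>])
      finally show ?thesis .
    qed
    then have "x \<in> C" by (simp add: C systematic_code_def x_def)
    moreover have "y = act_word (id, \<sigma>) x"
      using len by (auto simp: x_def permutes_inverses(1)[OF \<sigma>] intro!: nth_equalityI)
    ultimately show "y \<in> act_word (id, \<sigma>) ` C" by blast
  qed
  moreover have "(id, \<sigma>) \<in> sym_pairs n" using \<sigma> by (simp add: sym_pairs_def permutes_id)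
  ultimately show thesis using m' that by blast
qed

section \<open>Lengths 1, 2 and 3\<close>

lemma klein_perm_exists:
  assumes "p \<noteq> 0" "t \<noteq> 0" "p \<noteq> t"
  obtains \<sigma> where "\<sigma> permutes {KA, KB, KC}" "\<sigma> p = KA" "\<sigma> t = KB"
proof -
  let ?\<sigma> = "\<lambda>x. if x = 0 then 0 else if x = p then KA else if x = t then KB else KC"
  have "?\<sigma> permutes {KA, KB, KC}"
  proof (rule klein_permI)
    show "?\<sigma> (x + y) = ?\<sigma> x + ?\<sigma> y" for x y
      using assms by (cases p; cases t; cases x; cases y) (simp_all add: plus_klein_def zero_klein_def)
    show "x = 0" if "?\<sigma> x = 0" for x
      using that by (auto simp: zero_klein_def split: if_splits)
  qed
  then show thesis by (rule that) (use assms in auto)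
qed

lemma optimal_code_1:
  assumes C: "optimal_code 1 C"
  shows "((1, C), (1, gamma1)) \<in> code_equiv"
proof -
  note lin = optimal_codeD(1)[OF C]
  have "C \<noteq> {[0]}" using optimal_codeD(3)[OF C] by auto
  then obtain x where "x \<in> C" "x \<noteq> [0]" using linear_code_zero[OF lin] by auto
  moreover obtain v where "x = [v]"
    using linear_code_length[OF lin \<open>x \<in> C\<close>] by (auto simp: length_Suc_conv)
  ultimately have v: "[v] \<in> C" "v \<noteq> 0" by auto
  \<comment> \<open>An auxiliary second element; its image under \<open>\<sigma>\<close> is
    irrelevant.\<close>
  obtain t where "t \<noteq> 0" "v \<noteq> t" by (cases "v = KA") (auto simp: zero_klein_def)
  with v obtain \<sigma> where \<sigma>: "\<sigma> permutes {KA, KB, KC}" "\<sigma> v = KA" by (metis klein_perm_exists)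
  let ?g = "(id, \<lambda>_. \<sigma>)"
  have g: "?g \<in> sym_pairs 1" using \<sigma> by (simp add: sym_pairs_def permutes_id)
  have "[KA] \<in> act_word ?g ` C"
    using v \<sigma> by (intro image_eqI[of _ _ "[v]"]) (simp_all add: act_word_def)
  then have "act_word ?g ` C = gamma1"
    unfolding gamma1_eq by (intro optimal_code_eq_generate optimal_code_act C g) (simp, simp, code_simp)
  then show ?thesis using optimal_code_act(2)[OF C g] by simp
qed

text \<open>Here k = 1, and the normal form has a single check equation with identity coefficient:
  both coordinates are equal.\<close>

lemma optimal_code_2:
  assumes C: "optimal_code 2 C"
  shows "((2, C), (2, epsilon2)) \<in> code_equiv"
proof -
  obtain \<sigma> m where g: "(id, \<sigma>) \<in> sym_pairs 2" and m: "\<And>i. i \<in> {1..<2} \<Longrightarrow> m i 0 = id"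
    and D: "act_word (id, \<sigma>) ` C = systematic_code 2 1 m"
    by (rule MDS_normal_form[OF optimal_codeD(1)[OF C], of 1]) (use optimal_codeD(3,5)[OF C] in auto)
  have "{1..<2 :: nat} = {1}" by auto
  then have "set [[KA, KA], [KB, KB]] \<subseteq> act_word (id, \<sigma>) ` C"
    unfolding D systematic_code_def using m by simp
  then have "act_word (id, \<sigma>) ` C = epsilon2"
    unfolding epsilon2_eq by (intro optimal_code_eq_generate optimal_code_act C g) (simp, simp, code_simp)
  then show ?thesis using optimal_code_act(2)[OF C g] by simp
qed

lemma optimal_code_3:
  assumes C: "optimal_code 3 C"
  shows "((3, C), (3, delta3_plus)) \<in> code_equiv"
proof -
  note lin = optimal_codeD(1)[OF C]
  note add = linear_code_add[OF lin]
  have orth: "kdot a a' + (kdot b b' + kdot c c') = 0" if "[a, b, c] \<in> C" "[a', b', c'] \<in> C" for a b c a' b' c'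
  proof -
    have "word_inner 3 [a, b, c] [a', b', c'] = 0"
      using optimal_codeD(2)[OF C] that unfolding self_orthogonal_def by blast
    then show ?thesis by (simp only: numeral_3_eq_3 word_inner_Cons word_inner_Nil add_0_right)
  qed
  have wt: "1 < wt x" if "x \<in> C" "x \<noteq> [0, 0, 0]" for x
  proof -
    have "replicate 3 (0 :: klein) = [0, 0, 0]" by (simp add: numeral_3_eq_3)
    then show ?thesis using optimal_codeD(5)[OF C, of x] that by simp
  qed
  have form: "\<exists>a b c. x = [a, b, c]" if "x \<in> C" for x
    using linear_code_length[OF lin that] by (auto simp: eval_nat_numeral length_Suc_conv)
  have count: "card {x \<in> C. supp x = T} = 1" if "T \<subseteq> {..<3}" "card T = 2" for T
    using support_count[OF C that(1)] that(2) weight_counts(3) by (simp add: eval_nat_numeral)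
  have mem_supp: "0 \<in> supp [a, b, c] \<longleftrightarrow> a \<noteq> 0" "1 \<in> supp [a, b, c] \<longleftrightarrow> b \<noteq> 0"
    "2 \<in> supp [a, b, c] \<longleftrightarrow> c \<noteq> 0" for a b c
    by (simp_all add: supp_def)
  obtain x where x: "x \<in> C" "supp x = {0, 1}"
    using count[of "{0, 1}"] by (auto simp: card_1_singleton_iff)
  then obtain p q z where "x = [p, q, z]" using form by blast
  with x mem_supp[of p q z] have p: "x = [p, q, 0]" "p \<noteq> 0" "q \<noteq> 0" by simp_all
  obtain y where y: "y \<in> C" "supp y = {1, 2}"
    using count[of "{1, 2}"] by (auto simp: card_1_singleton_iff)
  then obtain z q' r where "y = [z, q', r]" using form by blast
  with y mem_supp[of z q' r] have q': "y = [0, q', r]" "q' \<noteq> 0" "r \<noteq> 0" by simp_all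
  \<comment> \<open>The supports of \<open>x\<close> and \<open>y\<close> meet in one coordinate,
    where orthogonality forces equal entries.\<close>
  have "kdot q q' = 0" using orth[of p q 0 0 q' r] x(1) y(1) p(1) q'(1) by simp
  then have "q' = q" using p(3) q'(2) by (simp add: kdot_def split: if_splits)
  define S where "S = {[0, 0, 0], x, y, map2 (+) x y}"
  \<comment> \<open>\<open>x\<close> and \<open>y\<close> account for at most 4 of the 8 codewords,
    so a third generator \<open>t\<close> exists.\<close>
  have "\<not> C \<subseteq> S"
  proof
    assume "C \<subseteq> S"
    then have "card C \<le> card S" by (rule card_mono[rotated]) (simp add: S_def)
    also have "\<dots> \<le> 4" unfolding S_def by (simp add: card_insert_if)
    finally show False using optimal_codeD(3)[OF C] by simp
  qed
  then obtain t where t: "t \<in> C" "t \<notin> S" by auto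
  then obtain a b c where abc: "t = [a, b, c]" using form by blast
  have eq: "kdot a p = kdot b q" "kdot b q = kdot c r"
    using orth[of p q 0 a b c] orth[of 0 q' r a b c] x y p q' t abc \<open>q' = q\<close>
    by (auto simp: kdot_def split: if_splits)
  \<comment> \<open>Otherwise each entry of \<open>t\<close> is 0 or the corresponding one of p, q,
    r. An even number of nonzero entries puts \<open>t\<close> into \<open>S\<close>; with an odd
    number, \<open>t\<close> or its sum with \<open>x\<close> has weight 1.\<close>
  have "kdot a p \<noteq> 0"
  proof
    assume "kdot a p = 0"
    then have *: "a \<in> {0, p}" "b \<in> {0, q}" "c \<in> {0, r}"
      using eq p q' by (auto simp: kdot_def split: if_splits)
    have "[p, q, 0] \<in> C" "[0, q, r] \<in> C" "map2 (+) x t \<in> C" using x y t p q' \<open>q' = q\<close> add by auto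
    then show False
      using * t p q' abc wt[of t] wt[of "map2 (+) x t"] \<open>q' = q\<close> by (auto simp: S_def)
  qed
  then have neq: "p \<noteq> a" "q \<noteq> b" "r \<noteq> c" "a \<noteq> 0" "b \<noteq> 0" "c \<noteq> 0"
    using eq by (auto simp: kdot_def split: if_splits)
  obtain \<alpha> where \<alpha>: "\<alpha> permutes {KA, KB, KC}" "\<alpha> p = KA" "\<alpha> a = KB"
    by (rule klein_perm_exists[of p a]) (use neq p in auto)
  obtain \<beta> where \<beta>: "\<beta> permutes {KA, KB, KC}" "\<beta> q = KA" "\<beta> b = KB"
    by (rule klein_perm_exists[of q b]) (use neq p in auto)
  obtain \<gamma> where \<gamma>: "\<gamma> permutes {KA, KB, KC}" "\<gamma> r = KA" "\<gamma> c = KB"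
    by (rule klein_perm_exists[of r c]) (use neq q' in auto)
  let ?g = "(id, (!) [\<alpha>, \<beta>, \<gamma>])"
  have g: "?g \<in> sym_pairs 3"
    using \<alpha> \<beta> \<gamma> by (auto simp: sym_pairs_def permutes_id less_Suc_eq numeral_3_eq_3)
  have act: "act_word ?g [u, v, w] = [\<alpha> u, \<beta> v, \<gamma> w]" for u v w
    by (simp add: act_word_def)
  have fix0: "\<alpha> 0 = KO" "\<beta> 0 = KO" "\<gamma> 0 = KO"
    using klein_permD(1) \<alpha>(1) \<beta>(1) \<gamma>(1) by (auto simp: zero_klein_def)
  have "act_word ?g ` {x, y, t} \<subseteq> act_word ?g ` C" using x y t by blast
  then have "set delta3_gens \<subseteq> act_word ?g ` C"
    using \<alpha> \<beta> \<gamma> fix0 by (simp add: p(1) q'(1) abc act \<open>q' = q\<close>)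
  then have "act_word ?g ` C = delta3_plus"
    unfolding delta3_plus_eq by (intro optimal_code_eq_generate optimal_code_act C g) (simp, simp, code_simp)
  then show ?thesis using optimal_code_act(2)[OF C g] by simp
qed

text \<open>The multiplication by a primitive element \<open>\<omega>\<close> under an identification of \<open>K\<close> with
  the field \<open>F\<^sub>4\<close>.\<close>

primrec rot :: "klein \<Rightarrow> klein" where
  "rot KO = KO" | "rot KA = KB" | "rot KB = KC" | "rot KC = KA"

lemma rot_permutes: "rot permutes {KA, KB, KC}"
proof (rule klein_permI)
  show "rot (x + y) = rot x + rot y" for x y
    by (cases x; cases y) (simp_all add: plus_klein_def zero_klein_def)
  show "x = 0" if "rot x = 0" for x using that by (cases x) (simp_all add: zero_klein_def)
qed

text \<open>A permutation of three points without fixed points is a 3-cycle.\<close>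

lemma klein_derangement:
  assumes f: "f permutes {KA, KB, KC}" and "\<And>y. y \<noteq> 0 \<Longrightarrow> f y \<noteq> y"
  shows "f = rot \<or> f = rot \<circ> rot"
proof -
  have "f KA \<noteq> KA" "f KB \<noteq> KB" "f KC \<noteq> KC" using assms(2) by (auto simp: zero_klein_def)
  then have "(\<forall>x. f x = rot x) \<or> (\<forall>x. f x = rot (rot x))"
    using klein_permD[OF f] by (auto simp: all_klein)
  then show ?thesis by (auto simp: fun_eq_iff)
qed

section \<open>Length 6\<close>

text \<open>Systematic encoder over F_4, with \<open>rot\<close> as multiplication by omega. The
  check coefficients form the matrix with rows (1, 1, 1), (1, omega, omega^2), (1, omega^2,
  omega).\<close>

definition hexacode_word :: "klein \<Rightarrow> klein \<Rightarrow> klein \<Rightarrow> klein list" where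
  "hexacode_word x y z = [x, y, z, x + y + z, x + rot y + rot (rot z), x + rot (rot y) + rot z]"

abbreviation "standard_hexacode_gens \<equiv>
  [hexacode_word KA 0 0, hexacode_word KB 0 0, hexacode_word 0 KA 0, hexacode_word 0 KB 0,
   hexacode_word 0 0 KA, hexacode_word 0 0 KB]"

lemma optimal_code_6:
  assumes C: "optimal_code 6 C"
  shows "((6, C), (6, generate (word_group 6) (set standard_hexacode_gens))) \<in> code_equiv"
proof -
  obtain \<sigma> m where g: "(id, \<sigma>) \<in> sym_pairs 6"
    and perm: "\<And>i j. i \<in> {3..<6} \<Longrightarrow> j < 3 \<Longrightarrow> m i j permutes {KA, KB, KC}"
    and m: "\<And>j. j < 3 \<Longrightarrow> m 3 j = id" "\<And>i. i \<in> {3..<6} \<Longrightarrow> m i 0 = id"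
    and sys: "act_word (id, \<sigma>) ` C = systematic_code 6 3 m"
    by (rule MDS_normal_form[OF optimal_codeD(1)[OF C], of 3]) (use optimal_codeD(3,5)[OF C] in auto)
  define D where "D = act_word (id, \<sigma>) ` C"
  have D: "optimal_code 6 D" and equiv_D: "((6, C), (6, D)) \<in> code_equiv"
    unfolding D_def using optimal_code_act[OF C g] .
  define \<beta> \<gamma> \<beta>' \<gamma>' where "\<beta> = m 4 1" and "\<gamma> = m 4 2" and "\<beta>' = m 5 1" and "\<gamma>' = m 5 2"
  note defs = \<beta>_def \<gamma>_def \<beta>'_def \<gamma>'_def
  have perms: "\<beta> permutes {KA, KB, KC}" "\<gamma> permutes {KA, KB, KC}"
    "\<beta>' permutes {KA, KB, KC}" "\<gamma>' permutes {KA, KB, KC}"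
    unfolding defs by (simp_all add: perm)
  have [simp]: "\<beta> 0 = 0" "\<gamma> 0 = 0" "\<beta>' 0 = 0" "\<gamma>' 0 = 0"
    using perms[THEN klein_permD(1)] by (simp_all add: zero_klein_def)
  have word: "[x, y, z, x + y + z, x + \<beta> y + \<gamma> z, x + \<beta>' y + \<gamma>' z] \<in> D" for x y z
  proof -
    have "{3..<6 :: nat} = {3, 4, 5}" "{..<3 :: nat} = {0, 1, 2}" by auto
    then show ?thesis
      unfolding D_def sys systematic_code_def defs using m by (simp add: add.assoc)
  qed
  have wt: "3 < wt [x, y, z, x + y + z, x + \<beta> y + \<gamma> z, x + \<beta>' y + \<gamma>' z]"
    if "x \<noteq> 0 \<or> y \<noteq> 0 \<or> z \<noteq> 0" for x y z
  proof -
    have "[x, y, z, x + y + z, x + \<beta> y + \<gamma> z, x + \<beta>' y + \<gamma>' z] \<noteq> replicate 6 0"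
      using that by (auto simp: numeral_eq_Suc)
    from optimal_codeD(5)[OF D word this] show ?thesis by simp
  qed
  \<comment> \<open>Each input has two nonzero information entries and makes a check vanish if it
    has none equal to zero already; at most four coordinates are left, so weight above 3 forces all
    of them to be nonzero.\<close>
  have neq: "\<beta> y \<noteq> y" "\<beta>' y \<noteq> y" "\<beta> y \<noteq> \<beta>' y" "\<gamma> y \<noteq> y" "\<gamma>' y \<noteq> y" "\<gamma> y \<noteq> \<gamma>' y"
    "\<beta> y \<noteq> \<gamma> y" "\<beta>' y \<noteq> \<gamma>' y" if "y \<noteq> 0" for y
  proof -
    show "\<beta> y \<noteq> y" "\<beta>' y \<noteq> y" using wt[of y y 0] that by (auto split: if_splits)
    show "\<beta> y \<noteq> \<beta>' y" using wt[of "\<beta> y" y 0] that by (auto split: if_splits)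
    show "\<gamma> y \<noteq> y" "\<gamma>' y \<noteq> y" using wt[of y 0 y] that by (auto split: if_splits)
    show "\<gamma> y \<noteq> \<gamma>' y" using wt[of "\<gamma> y" 0 y] that by (auto split: if_splits)
    show "\<beta> y \<noteq> \<gamma> y" "\<beta>' y \<noteq> \<gamma>' y" using wt[of 0 y y] that by (auto split: if_splits)
  qed
  note klein_derangement[OF perms(1) neq(1)] klein_derangement[OF perms(2) neq(4)]
    klein_derangement[OF perms(3) neq(2)] klein_derangement[OF perms(4) neq(5)]
  moreover have "\<beta> \<noteq> \<beta>'" "\<gamma> \<noteq> \<gamma>'" "\<beta> \<noteq> \<gamma>"
    using neq[of KA] by (auto simp: zero_klein_def)
  \<comment> \<open>All four coefficients are \<open>rot\<close> or its square, and they differ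
    along each row and each column of the 2 by 2 block; two patterns remain.\<close>
  ultimately consider
      "\<beta> = rot" "\<gamma> = rot \<circ> rot" "\<beta>' = rot \<circ> rot" "\<gamma>' = rot"
    | "\<beta> = rot \<circ> rot" "\<gamma> = rot" "\<beta>' = rot" "\<gamma>' = rot \<circ> rot" by metis
  then show ?thesis
  proof cases
    case 1
    then have "hexacode_word x y z \<in> D" for x y z
      using word[of x y z] by (simp add: hexacode_word_def)
    then have "D = generate (word_group 6) (set standard_hexacode_gens)"
      by (intro optimal_code_eq_generate D) (simp, simp, code_simp)
    then show ?thesis using equiv_D by simp
  next
    case 2
    \<comment> \<open>The second pattern is the first with its last two coordinates
      exchanged.\<close>
    let ?g = "(transpose 4 5, \<lambda>_. id)"
    have g: "?g \<in> sym_pairs 6" by (simp add: sym_pairs_def permutes_id permutes_swap_id)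
    have "hexacode_word x y z \<in> act_word ?g ` D" for x y z
      using imageI[OF word[of x y z], of "act_word ?g"] 2
      by (simp add: hexacode_word_def act_word_def transpose_def)
    then have "act_word ?g ` D = generate (word_group 6) (set standard_hexacode_gens)"
      by (intro optimal_code_eq_generate optimal_code_act D g) (simp, simp, code_simp)
    then have "((6, D), (6, generate (word_group 6) (set standard_hexacode_gens))) \<in> code_equiv"
      using optimal_code_act(2)[OF D g] by simp
    then show ?thesis using equiv_D equiv_code_equiv by (meson equivE transE)
  qed
qed

section \<open>Length 5\<close>

text \<open>Evaluates a linear form with coefficients x, y at the five points of the projective line
  over F_4. A nonzero form has one zero there, so all nonzero words have weight 4.\<close>

definition shorter_hexacode_word :: "klein \<Rightarrow> klein \<Rightarrow> klein list" where
  "shorter_hexacode_word x y = [x, y, x + y, x + rot y, x + rot (rot y)]"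

lemma rot_rot_rot: "rot (rot (rot x)) = x"
  by (cases x) simp_all

lemma map_rot_shorter_hexacode_word:
  "map rot (shorter_hexacode_word x y) = shorter_hexacode_word (rot x) (rot y)"
  by (simp add: shorter_hexacode_word_def klein_perm_add[OF rot_permutes])

abbreviation "standard_shorter_hexacode_gens \<equiv>
  [shorter_hexacode_word KA 0, shorter_hexacode_word KB 0,
   shorter_hexacode_word 0 KA, shorter_hexacode_word 0 KB, [0, 0, KA, KC, KB]]"

text \<open>The words of even weight form an MDS code with parameters \<open>(5, 4\<^sup>2, 4)\<close>.\<close>

lemma optimal_code_5_even_part:
  assumes C: "optimal_code 5 C"
  obtains D where "optimal_code 5 D" "((5, C), (5, D)) \<in> code_equiv"
    and "\<And>x y. shorter_hexacode_word x y \<in> D"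
proof -
  note lin = optimal_codeD(1)[OF C]
  note len = linear_code_length[OF lin]
  let ?C\<^sub>0 = "{x \<in> C. even (wt x)}"
  have lin0: "linear_code 5 ?C\<^sub>0"
    using linear_codeD[OF lin] optimal_codeD(2)[OF C] wt_eq_0_iff[of "replicate 5 0" 5]
    by (intro linear_codeI) (simp_all add: even_wt_add[of _ 5] self_orthogonal_def)
  have "C \<inter> words_on 5 {..<5} = C" using len by (auto simp: words_on_def supp_def)
  then have card0: "card ?C\<^sub>0 = 4 ^ 2"
    using card_optimal_code_filter[OF C, of "{..<5}" even] even_counts(2) by (simp cong: if_cong)
  have wt0: "3 < wt x" if "x \<in> ?C\<^sub>0" "x \<noteq> replicate 5 0" for x
  proof -
    have "2 < wt x" using optimal_codeD(5)[OF C, of x] that by simp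
    then show ?thesis using that by (cases "wt x = 3") auto
  qed
  obtain \<sigma> m where g: "(id, \<sigma>) \<in> sym_pairs 5"
    and perm: "\<And>i j. i \<in> {2..<5} \<Longrightarrow> j < 2 \<Longrightarrow> m i j permutes {KA, KB, KC}"
    and m: "\<And>j. j < 2 \<Longrightarrow> m 2 j = id" "\<And>i. i \<in> {2..<5} \<Longrightarrow> m i 0 = id"
    and sys: "act_word (id, \<sigma>) ` ?C\<^sub>0 = systematic_code 5 2 m"
    by (rule MDS_normal_form[OF lin0 card0]) (use wt0 in auto)
  \<comment> \<open>The normalisation found for the even words is applied to the whole code.\<close>
  define D where "D = act_word (id, \<sigma>) ` C"
  have D: "optimal_code 5 D" and equiv_D: "((5, C), (5, D)) \<in> code_equiv"
    unfolding D_def using optimal_code_act[OF C g] .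
  define \<beta> \<beta>' where "\<beta> = m 3 1" and "\<beta>' = m 4 1"
  have perms: "\<beta> permutes {KA, KB, KC}" "\<beta>' permutes {KA, KB, KC}"
    unfolding \<beta>_def \<beta>'_def by (simp_all add: perm)
  have [simp]: "\<beta> 0 = 0" "\<beta>' 0 = 0"
    using perms[THEN klein_permD(1)] by (simp_all add: zero_klein_def)
  have word: "[x, y, x + y, x + \<beta> y, x + \<beta>' y] \<in> act_word (id, \<sigma>) ` ?C\<^sub>0" for x y
  proof -
    have "{2..<5 :: nat} = {2, 3, 4}" "{..<2 :: nat} = {0, 1}" by auto
    then show ?thesis
      unfolding sys systematic_code_def \<beta>_def \<beta>'_def using m by simp
  qed
  \<comment> \<open>Pulled back to even words of \<open>C\<close>, since as an element of
    \<open>D\<close> a word is only known to have weight above 2.\<close>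
  have wt: "3 < wt [x, y, x + y, x + \<beta> y, x + \<beta>' y]" if "x \<noteq> 0 \<or> y \<noteq> 0" for x y
  proof -
    obtain c where c: "c \<in> ?C\<^sub>0" "[x, y, x + y, x + \<beta> y, x + \<beta>' y] = act_word (id, \<sigma>) c"
      using word[of x y] by auto
    have "wt [x, y, x + y, x + \<beta> y, x + \<beta>' y] = wt c"
      unfolding c(2) using c(1) by (intro wt_act_word[OF g]) (simp add: len)
    moreover from this have "c \<noteq> replicate 5 0"
      using that wt_eq_0_iff[of c 5] len c(1) by (auto split: if_splits)
    ultimately show ?thesis using wt0[OF c(1)] by simp
  qed
  have neq: "\<beta> y \<noteq> y" "\<beta>' y \<noteq> y" "\<beta> y \<noteq> \<beta>' y" if "y \<noteq> 0" for y
  proof -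
    show "\<beta> y \<noteq> y" "\<beta>' y \<noteq> y" using wt[of y y] that by (auto split: if_splits)
    show "\<beta> y \<noteq> \<beta>' y" using wt[of "\<beta> y" y] that by (auto split: if_splits)
  qed
  have "\<beta> \<noteq> \<beta>'" using neq[of KA] by (auto simp: zero_klein_def)
  then consider "\<beta> = rot" "\<beta>' = rot \<circ> rot" | "\<beta> = rot \<circ> rot" "\<beta>' = rot"
    using klein_derangement[OF perms(1) neq(1)] klein_derangement[OF perms(2) neq(2)] by metis
  then show thesis
  proof cases
    case 1
    have "shorter_hexacode_word x y \<in> D" for x y
      using word[of x y] 1 by (auto simp: shorter_hexacode_word_def D_def)
    with D equiv_D that show thesis by blast
  next
    case 2
    let ?g = "(transpose 3 4, \<lambda>_. id)"
    have g: "?g \<in> sym_pairs 5" by (simp add: sym_pairs_def permutes_id permutes_swap_id)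
    have word': "[x, y, x + y, x + \<beta> y, x + \<beta>' y] \<in> D" for x y
      using word[of x y] by (auto simp: D_def)
    have "shorter_hexacode_word x y \<in> act_word ?g ` D" for x y
      using imageI[OF word'[of x y], of "act_word ?g"] 2
      by (simp add: shorter_hexacode_word_def act_word_def transpose_def)
    moreover have "((5, C), (5, act_word ?g ` D)) \<in> code_equiv"
      using equiv_D optimal_code_act(2)[OF D g] equiv_code_equiv by (meson equivE transE)
    ultimately show thesis using that optimal_code_act(1)[OF D g] by blast
  qed
qed

lemma optimal_code_5:
  assumes C: "optimal_code 5 C"
  shows "((5, C), (5, generate (word_group 5) (set standard_shorter_hexacode_gens))) \<in> code_equiv"
proof -
  obtain D where D: "optimal_code 5 D" and equiv_D: "((5, C), (5, D)) \<in> code_equiv"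
    and word: "\<And>x y. shorter_hexacode_word x y \<in> D"
    using optimal_code_5_even_part[OF C] by metis
  note lin = optimal_codeD(1)[OF D]
  let ?S = "(\<lambda>(x, y). shorter_hexacode_word x y) ` (UNIV \<times> UNIV)"
  have fin: "finite (UNIV \<times> UNIV :: (klein \<times> klein) set)" by (simp add: UNIV_klein)
  have "card ?S \<le> 16"
    using card_image_le[OF fin, of "\<lambda>(x, y). shorter_hexacode_word x y"]
    by (simp add: card_cartesian_product UNIV_klein)
  moreover have "card D = 32" using optimal_codeD(3)[OF D] by simp
  ultimately have "\<not> D \<subseteq> ?S" using card_mono[OF finite_imageI[OF fin]] by fastforce
  then obtain t where t: "t \<in> D" "\<And>x y. t \<noteq> shorter_hexacode_word x y" by fastforce
  obtain x y u v w where t_eq: "t = [x, y, u, v, w]"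
    using linear_code_length[OF lin t(1)] by (auto simp: numeral_eq_Suc length_Suc_conv)
  \<comment> \<open>Subtracts the word of the 16-element subcode that agrees with \<open>t\<close>
    in the first two coordinates.\<close>
  define a b c where "a = u + (x + y)" and "b = v + (x + rot y)" and "c = w + (x + rot (rot y))"
  have abc: "[0, 0, a, b, c] \<in> D"
    using linear_code_add[OF lin t(1) word[of x y]]
    by (simp add: t_eq shorter_hexacode_word_def a_def b_def c_def)
  have "a \<noteq> 0 \<or> b \<noteq> 0 \<or> c \<noteq> 0"
    using t(2)[of x y] by (auto simp: t_eq shorter_hexacode_word_def a_def b_def c_def)
  then have "[0, 0, a, b, c] \<noteq> replicate 5 0" by (auto simp: numeral_eq_Suc)
  from optimal_codeD(5)[OF D abc this] have "a \<noteq> 0" "b \<noteq> 0" "c \<noteq> 0"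
    by (auto split: if_splits)
  moreover have "kdot a z + (kdot b z + kdot c z) = 0"
    "kdot a z + (kdot b (rot z) + kdot c (rot (rot z))) = 0" for z
  proof -
    have orth: "word_inner 5 [0, 0, a, b, c] (shorter_hexacode_word x y) = 0" for x y
      using optimal_codeD(2)[OF D] abc word unfolding self_orthogonal_def by blast
    have "rot 0 = 0" by (simp add: zero_klein_def)
    then have "word_inner 5 [0, 0, a, b, c] [z, 0, z, z, z] = 0"
      "word_inner 5 [0, 0, a, b, c] [0, z, z, rot z, rot (rot z)] = 0"
      using orth[of z 0] orth[of 0 z] by (simp_all add: shorter_hexacode_word_def)
    moreover have "(5 :: nat) = Suc (Suc (Suc (Suc (Suc 0))))" by simp
    ultimately show "kdot a z + (kdot b z + kdot c z) = 0"
      "kdot a z + (kdot b (rot z) + kdot c (rot (rot z))) = 0"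
      by (simp_all only: word_inner_Cons word_inner_Nil kdot_0 add_0_left add_0_right)
  qed
  \<comment> \<open>Both equations are additive in \<open>z\<close>, so \<open>KA\<close> and
    \<open>KB\<close> suffice. The solutions without zero entries are the three multiples of
    (\<open>KA\<close>, \<open>KC\<close>, \<open>KB\<close>) under \<open>rot\<close>.\<close>
  from this[of KA] this[of KB] calculation
  consider "a = KA" "b = KC" "c = KB" | "a = KB" "b = KA" "c = KC" | "a = KC" "b = KB" "c = KA"
    by (cases a; cases b; cases c) (simp_all add: kdot_def zero_klein_def)
  \<comment> \<open>A scalar multiplication carries the given multiple to the standard one and maps
    the F_4-linear code of the \<open>shorter_hexacode_word\<close>s onto itself.\<close>
  then have "\<exists>\<tau>. \<tau> permutes {KA, KB, KC} \<and> map \<tau> [0, 0, a, b, c] = [0, 0, KA, KC, KB] \<and>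
      (\<forall>x y. shorter_hexacode_word x y \<in> map \<tau> ` D)"
  proof cases
    case 1
    then show ?thesis using word by (intro exI[of _ id]) (simp add: permutes_id)
  next
    case 2
    have "shorter_hexacode_word x y = map (rot \<circ> rot) (shorter_hexacode_word (rot x) (rot y))" for x y
      by (simp add: map_rot_shorter_hexacode_word rot_rot_rot flip: map_map)
    then have "shorter_hexacode_word x y \<in> map (rot \<circ> rot) ` D" for x y using word by blast
    with 2 show ?thesis
      by (intro exI[of _ "rot \<circ> rot"]) (simp add: permutes_compose rot_permutes zero_klein_def)
  next
    case 3
    have "shorter_hexacode_word x y = map rot (shorter_hexacode_word (rot (rot x)) (rot (rot y)))" for x y
      by (simp add: map_rot_shorter_hexacode_word rot_rot_rot)
    then have "shorter_hexacode_word x y \<in> map rot ` D" for x y using word by blast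
    with 3 show ?thesis by (intro exI[of _ rot]) (simp add: rot_permutes zero_klein_def)
  qed
  then obtain \<tau> where \<tau>: "\<tau> permutes {KA, KB, KC}" "map \<tau> [0, 0, a, b, c] = [0, 0, KA, KC, KB]"
    "\<forall>x y. shorter_hexacode_word x y \<in> map \<tau> ` D" by (elim exE conjE)
  let ?g = "(id, \<lambda>_. \<tau>)"
  have g: "?g \<in> sym_pairs 5" using \<tau>(1) by (simp add: sym_pairs_def permutes_id)
  have act: "act_word ?g ` D = map \<tau> ` D"
    by (auto simp: act_word_def map_nth intro!: image_cong nth_equalityI)
  have "[0, 0, KA, KC, KB] \<in> map \<tau> ` D" using abc \<tau>(2) by (metis imageI)
  then have "set standard_shorter_hexacode_gens \<subseteq> act_word ?g ` D"
    unfolding act using \<tau>(3) by simp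
  then have "act_word ?g ` D = generate (word_group 5) (set standard_shorter_hexacode_gens)"
    by (intro optimal_code_eq_generate optimal_code_act D g) (simp, simp, code_simp)
  then show ?thesis
    using equiv_D optimal_code_act(2)[OF D g] equiv_code_equiv by (metis equivE transE)
qed

section \<open>The classification\<close>

theorem theorem12:
  shows "let L = {(1, gamma1), (2, epsilon2), (3, delta3_plus), (5, shorter_hexacode), (6, hexacode)}
    in L \<subseteq> extremal_codes \<and>
       (\<forall>p\<in>extremal_codes. \<exists>q\<in>L. (p, q) \<in> code_equiv) \<and>
       card (extremal_codes // code_equiv) = 5"
proof -
  define L :: "(nat \<times> klein list set) set"
    where "L = {(1, gamma1), (2, epsilon2), (3, delta3_plus), (5, shorter_hexacode), (6, hexacode)}"
  have L: "L \<subseteq> extremal_codes"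
    using optimal_codes optimal_imp_extremal by (auto simp: L_def extremal_codes_def)
  have ex: "\<exists>q\<in>L. (p, q) \<in> code_equiv" if "p \<in> extremal_codes" for p
  proof -
    obtain n C where p: "p = (n, C)" "n \<ge> 1" "extremal_code n C"
      using \<open>p \<in> extremal_codes\<close> by (auto simp: extremal_codes_def)
    have C: "optimal_code n C" using p(3) by (rule extremal_imp_optimal)
    \<comment> \<open>Stated for two codes equivalent to a common third, because in lengths 5 and 6
      the given code and the named code are both compared with the standard one.\<close>
    have trans: "(r, t) \<in> code_equiv" if "(r, s) \<in> code_equiv" "(t, s) \<in> code_equiv" for r s t
      using that equiv_code_equiv by (meson equivE symE transE)
    consider "n = 1" | "n = 2" | "n = 3" | "n = 5" | "n = 6"
      using optimal_code_length[OF C p(2)] by auto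
    then show ?thesis
    proof cases
      case 1
      then show ?thesis using optimal_code_1 C p(1) by (auto simp: L_def)
    next
      case 2
      then show ?thesis using optimal_code_2 C p(1) by (auto simp: L_def)
    next
      case 3
      then show ?thesis using optimal_code_3 C p(1) by (auto simp: L_def)
    next
      case 4
      then have "(p, (5, shorter_hexacode)) \<in> code_equiv"
        using trans[OF optimal_code_5 optimal_code_5[OF optimal_codes(4)]] C p(1) by simp
      then show ?thesis by (auto simp: L_def)
    next
      case 5
      then have "(p, (6, hexacode)) \<in> code_equiv"
        using trans[OF optimal_code_6 optimal_code_6[OF optimal_codes(5)]] C p(1) by simp
      then show ?thesis by (auto simp: L_def)
    qed
  qed
  have lin: "extremal_codes \<subseteq> {(n, C). linear_code n C}"
    by (auto simp: extremal_codes_def extremal_code_def self_dual_def)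
  have "extremal_codes // code_equiv = (\<lambda>q. code_equiv `` {q}) ` L"
  proof (intro equalityI subsetI)
    fix X assume "X \<in> extremal_codes // code_equiv"
    then obtain p where p: "p \<in> extremal_codes" "X = code_equiv `` {p}" by (auto elim: quotientE)
    then obtain q where "q \<in> L" "(p, q) \<in> code_equiv" using ex by blast
    then show "X \<in> (\<lambda>q. code_equiv `` {q}) ` L"
      using p(2) equiv_class_eq[OF equiv_code_equiv] by blast
  next
    fix X assume "X \<in> (\<lambda>q. code_equiv `` {q}) ` L"
    then show "X \<in> extremal_codes // code_equiv" using L by (auto intro: quotientI)
  qed
  \<comment> \<open>Equivalent codes have equal length, and the five lengths are distinct.\<close>
  moreover have "inj_on (\<lambda>q. code_equiv `` {q}) L"
  proof (rule inj_onI)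
    fix p q assume pq: "p \<in> L" "q \<in> L" "code_equiv `` {p} = code_equiv `` {q}"
    then have "(p, q) \<in> code_equiv"
      using L lin eq_equiv_class[OF pq(3) equiv_code_equiv] by blast
    then have "fst p = fst q" by (auto simp: code_equiv_def)
    then show "p = q" using pq by (auto simp: L_def)
  qed
  moreover have "card L = 5" by (simp add: L_def)
  ultimately have "card (extremal_codes // code_equiv) = 5" by (simp add: card_image)
  with L ex show ?thesis unfolding L_def[symmetric] by (simp add: Let_def)
qed

end
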